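(* Let $G$ be a finite simple graph on $[n]$. Suppose there exists a cutset $T'\in\mathscr C(G)$ such that $\mathrm{v}(\mathrm{in}_<(J_G))$ is attained at some associated prime of the form $P_{T'}(\mathbf v')$ of $\mathrm{in}_<(J_G)$ (i.e. $\mathrm{v}(\mathrm{in}_<(J_G))=\mathrm{v}_{P_{T'}(\mathbf v')}(\mathrm{in}_<(J_G))$ for some $\mathbf v'\in V(G'_1)\times\cdots\times V(G'_{c(T')})$, where $G'_1,\dots,G'_{c(T')}$ are the connected components of $G\setminus T'$), and such that $\mathrm{in}_<\big(\bigcap_{T\in\mathscr C(G)\setminus\{T'\}}P_T(G)\big)$ is a radical ideal. Then $$\mathrm{v}(J_G)\le \mathrm{v}(\mathrm{in}_<(J_G)).$$
   Context: Let $K$ be a field, $G$ a finite simple graph on $V(G)=[n]=\{1,\dots,n\}$, $S=K[x_1,\dots,x_n,y_1,\dots,y_n]$ with the standard grading, and $f_{ij}=x_iy_j-x_jy_i$. The binomial edge ideal of $G$ is $J_G=\langle f_{ij}\mid\{i,j\}\in E(G), i<j\rangle$. The monomial order $<$ on $S$ is the lexicographic order induced by $x_1>\cdots>x_n>y_1>\cdots>y_n$, and $\mathrm{in}_<(I)$ is the initial ideal of $I$. For a proper graded ideal $I$ of $S$ and $\mathfrak p\in\mathrm{Ass}(I)$ (associated primes of $S/I$), $\mathrm{v}_{\mathfrak p}(I)=\min\{d\ge 0\mid \exists f\in S_d\text{ with }(I:f)=\mathfrak p\}$ and $\mathrm{v}(I)=\min\{\mathrm{v}_{\mathfrak p}(I)\mid\mathfrak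 p\in\mathrm{Ass}(I)\}$. $G\setminus T$ is the induced subgraph of $G$ on $V(G)\setminus T$. A vertex is a cut vertex of a graph if its removal increases the number of connected components. $T\subseteq[n]$ is a cutset of $G$ if each $t\in T$ is a cut vertex of $G\setminus(T\setminus\{t\})$ (so $\emptyset$ is a cutset); $\mathscr C(G)$ is the set of cutsets. For $T\in\mathscr C(G)$, let $G_1,\dots,G_{c(T)}$ be the connected components of $G\setminus T$. Define $P_T(G)=\langle x_i,y_i\mid i\in T\rangle+\langle f_{ij}\mid i<j \text{ in the same component of } G\setminus T\rangle$; these primes are exactly the minimal (= associated) primes of the radical ideal $J_G$. For $\mathbf v=(v_1,\dots,v_{c(T)})\in V(G_1)\times\cdots\times V(G_{c(T)})$ define the monomial prime $$P_T(\mathbf v)=\langle x_i,y_i\mid i\in T\rangle+\sum_{k=1}^{c(T)}\langle x_i,\,y_j\mid i,j\in V(G_k),\ i<v_k,\ j>v_k\rangle .$$ It is known that $\mathrm{Ass}(\mathrm{in}_<(J_G))$ is the set of all $P_T(\mathbf v)$ with $T\in\mathscr C(G)$ and $\mathbf v\in V(G_1)\times\cdots\times V(G_{c(T)})$, where $G_1,\dots,G_{c(T)}$ are the connected components of $G\setminus T$. An empty intersection of ideals is $S$. *)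

theory Defs
  imports
    Main
    "HOL-Library.Poly_Mapping"
    "HOL-Library.FuncSet"
    "HOL-Library.Extended_Nat"
begin

text \<open>
  The vertex set \<open>[n]\<close> is rendered as an arbitrary finite linearly ordered type \<open>'n\<close>
  (so \<open>n\<close> is the cardinality of \<open>'n\<close>), and a graph on it by its set of edges, a symmetric
  irreflexive relation on \<open>'n\<close>. The polynomial ring \<open>S\<close> is the whole type \<open>('n, 'k) bpoly\<close>.
\<close>

datatype 'n var = X 'n | Y 'n

text \<open>
  \<open>X i\<close> comes before \<open>X j\<close> for \<open>i < j\<close>, and every \<open>X i\<close> before every \<open>Y j\<close>. As index positions
  of exponent vectors, \<^emph>\<open>earlier\<close> indeterminates are the more significant ones, see
  \<open>monomial_less_iff\<close>.
\<close>

instantiation var :: (linorder) linorder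
begin

fun less_eq_var :: "'a var \<Rightarrow> 'a var \<Rightarrow> bool" where
  "less_eq_var (X i) (X j) \<longleftrightarrow> i \<le> j"
| "less_eq_var (X i) (Y j) \<longleftrightarrow> True"
| "less_eq_var (Y i) (X j) \<longleftrightarrow> False"
| "less_eq_var (Y i) (Y j) \<longleftrightarrow> i \<le> j"

definition less_var :: "'a var \<Rightarrow> 'a var \<Rightarrow> bool" where
  "less_var u w \<longleftrightarrow> u \<le> w \<and> \<not> w \<le> u"

instance
proof
  fix u w z :: "'a var"
  show "u < w \<longleftrightarrow> u \<le> w \<and> \<not> w \<le> u" by (rule less_var_def)
  show "u \<le> u" by (cases u) auto
  show "u \<le> w \<Longrightarrow> w \<le> z \<Longrightarrow> u \<le> z" by (cases u; cases w; cases z) auto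
  show "u \<le> w \<Longrightarrow> w \<le> u \<Longrightarrow> u = w" by (cases u; cases w) auto
  show "u \<le> w \<or> w \<le> u" by (cases u; cases w) auto
qed

end

type_synonym 'n mon = "'n var \<Rightarrow>\<^sub>0 nat"
type_synonym ('n, 'k) bpoly = "'n mon \<Rightarrow>\<^sub>0 'k"

text \<open>
  The library order on \<open>'n mon\<close> is the lexicographic order induced by
  \<open>x\<^sub>1 > \<dots> > x\<^sub>n > y\<^sub>1 > \<dots> > y\<^sub>n\<close>: the first indeterminate in this list at which the
  exponents differ decides.
\<close>

lemma monomial_less_iff:
  fixes m m' :: "('n::linorder) mon"
  shows "m < m' \<longleftrightarrow>
    (\<exists>u. Poly_Mapping.lookup m u < Poly_Mapping.lookup m' u \<and>
         (\<forall>w<u. Poly_Mapping.lookup m w = Poly_Mapping.lookup m' w))"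
  by transfer (simp add: less_fun_def)

definition indet :: "'n var \<Rightarrow> ('n, 'k::field) bpoly" where
  "indet u = Poly_Mapping.single (Poly_Mapping.single u 1) 1"

definition edge_binomial :: "'n \<Rightarrow> 'n \<Rightarrow> ('n, 'k::field) bpoly" where
  "edge_binomial i j = indet (X i) * indet (Y j) - indet (X j) * indet (Y i)"

definition mon_degree :: "'n mon \<Rightarrow> nat" where
  "mon_degree m = (\<Sum>u\<in>Poly_Mapping.keys m. Poly_Mapping.lookup m u)"

definition homogeneous_part :: "nat \<Rightarrow> ('n, 'k::field) bpoly set" where
  "homogeneous_part d = {f. \<forall>m\<in>Poly_Mapping.keys f. mon_degree m = d}"


subsection \<open>Ideals\<close>

text \<open>An ideal is a submodule of the ring regarded as a module over itself.\<close>

definition is_ideal :: "'a::comm_ring_1 set \<Rightarrow> bool" where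
  "is_ideal I \<longleftrightarrow> module.subspace (*) I"

definition ideal_gen :: "'a::comm_ring_1 set \<Rightarrow> 'a set" where
  "ideal_gen B = module.span (*) B"

definition is_prime_ideal :: "'a::comm_ring_1 set \<Rightarrow> bool" where
  "is_prime_ideal P \<longleftrightarrow>
     is_ideal P \<and> P \<noteq> UNIV \<and> (\<forall>a b. a * b \<in> P \<longrightarrow> a \<in> P \<or> b \<in> P)"

definition is_radical_ideal :: "'a::comm_ring_1 set \<Rightarrow> bool" where
  "is_radical_ideal I \<longleftrightarrow> is_ideal I \<and> (\<forall>a k. a ^ k \<in> I \<longrightarrow> a \<in> I)"

definition colon :: "'a::comm_ring_1 set \<Rightarrow> 'a \<Rightarrow> 'a set" where
  "colon I f = {g. g * f \<in> I}"

text \<open>Associated primes of the quotient by \<open>I\<close>: prime annihilators of residue classes.\<close>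

definition Ass :: "'a::comm_ring_1 set \<Rightarrow> 'a set set" where
  "Ass I = {P. is_prime_ideal P \<and> (\<exists>f. P = colon I f)}"

text \<open>
  Both infima are minima whenever the set is nonempty, as \<open>enat\<close> is well-ordered; the value
  \<open>\<infinity>\<close> is only taken when there is nothing to minimise over.
\<close>

definition v_local :: "('n, 'k::field) bpoly set \<Rightarrow> ('n, 'k) bpoly set \<Rightarrow> enat" where
  "v_local P I = Inf {enat d | d. \<exists>f\<in>homogeneous_part d. colon I f = P}"

definition v_number :: "('n, 'k::field) bpoly set \<Rightarrow> enat" where
  "v_number I = (INF P\<in>Ass I. v_local P I)"

definition initial_mon :: "('n::linorder, 'k::field) bpoly \<Rightarrow> 'n mon" where
  "initial_mon f = Max (Poly_Mapping.keys f)"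

definition initial_ideal :: "('n::linorder, 'k::field) bpoly set \<Rightarrow> ('n, 'k) bpoly set" where
  "initial_ideal I = ideal_gen {Poly_Mapping.single (initial_mon f) 1 | f. f \<in> I \<and> f \<noteq> 0}"


subsection \<open>Components and cutsets\<close>

text \<open>The vertex sets of the connected components of the induced subgraph on \<open>W\<close>.\<close>

definition components_on :: "('n \<times> 'n) set \<Rightarrow> 'n set \<Rightarrow> 'n set set" where
  "components_on E W = W // {(u, w) \<in> W \<times> W. (u, w) \<in> (E \<inter> W \<times> W)\<^sup>*}"

definition cut_vertex_on :: "('n \<times> 'n) set \<Rightarrow> 'n set \<Rightarrow> 'n \<Rightarrow> bool" where
  "cut_vertex_on E W t \<longleftrightarrow>
     t \<in> W \<and> card (components_on E W) < card (components_on E (W - {t}))"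

definition cutsets :: "('n \<times> 'n) set \<Rightarrow> 'n set set" where
  "cutsets E = {T. \<forall>t\<in>T. cut_vertex_on E (- (T - {t})) t}"


subsection \<open>Binomial edge ideals\<close>

definition binomial_edge_ideal ::
    "('n::linorder \<times> 'n) set \<Rightarrow> ('n, 'k::field) bpoly set" where
  "binomial_edge_ideal E = ideal_gen {edge_binomial i j | i j. (i, j) \<in> E \<and> i < j}"

text \<open>A sum of ideals given by generators is written as the ideal of the joint generators.\<close>

definition cutset_prime ::
    "('n::linorder \<times> 'n) set \<Rightarrow> 'n set \<Rightarrow> ('n, 'k::field) bpoly set" where
  "cutset_prime E T = ideal_gen
     ({indet (X i) | i. i \<in> T} \<union> {indet (Y i) | i. i \<in> T} \<union>
      {edge_binomial i j | i j. i < j \<and> (\<exists>C\<in>components_on E (- T). i \<in> C \<and> j \<in> C)})"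

text \<open>
  A tuple in \<open>V(G\<^sub>1) \<times> \<dots> \<times> V(G\<^sub>c)\<close> is a choice function \<open>v\<close> on the components, with
  \<open>v C \<in> C\<close>; its values on other sets are irrelevant.
\<close>

definition monomial_prime ::
    "('n::linorder \<times> 'n) set \<Rightarrow> 'n set \<Rightarrow> ('n set \<Rightarrow> 'n) \<Rightarrow> ('n, 'k::field) bpoly set" where
  "monomial_prime E T v = ideal_gen
     ({indet (X i) | i. i \<in> T} \<union> {indet (Y i) | i. i \<in> T} \<union>
      (\<Union>C\<in>components_on E (- T).
         {indet (X i) | i. i \<in> C \<and> i < v C} \<union> {indet (Y j) | j. j \<in> C \<and> v C < j}))"

end

theory Submission
  imports Defs
begin

text \<open>
  Write \<open>J\<close> for the binomial edge ideal, \<open>P\<^sub>T\<close> for \<^const>\<open>cutset_prime\<close> and \<open>Q\<close> for the intersection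
  of the \<open>P\<^sub>T\<close> over the cutsets \<open>T \<noteq> T'\<close>. Since \<open>J = Q \<inter> P\<^sub>T\<^sub>'\<close> and \<open>P\<^sub>T\<^sub>'\<close> is prime, every \<open>g\<close> in \<open>Q\<close>
  outside \<open>P\<^sub>T\<^sub>'\<close> satisfies \<open>(J : g) = P\<^sub>T\<^sub>'\<close>. So it suffices to find a homogeneous such \<open>g\<close> whose
  degree is that of a given \<open>f\<close> with \<open>(in J : f) = P\<^sub>T\<^sub>'(v')\<close>.

  Some monomial \<open>m\<close> of \<open>f\<close> avoids the variables of \<open>P\<^sub>T\<^sub>'(v')\<close>, because \<open>in J\<close> is radical, while
  every such variable multiplies \<open>m\<close> into \<open>in J\<close>. If \<open>m\<close> were outside \<open>in P\<^sub>T\<close> for a cutset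
  \<open>T \<noteq> T'\<close>, it would be outside some \<open>P\<^sub>T(v)\<close>, which would then contain \<open>P\<^sub>T\<^sub>'(v')\<close>; but distinct
  cutsets have incomparable monomial primes (\<open>cutset_prime_vars_incomparable\<close>). Hence \<open>m\<close> is
  an initial monomial of an element of each of these \<open>P\<^sub>T\<close>; the product of these elements lies in
  \<open>Q\<close>, so a power of \<open>m\<close> lies in \<open>in Q\<close>, and by radicality so does \<open>m\<close>. Thus \<open>m = in q\<close> with
  \<open>q\<close> in \<open>Q\<close>, and \<open>g\<close> is the homogeneous component of \<open>q\<close> that contains \<open>m\<close>. It is not in
  \<open>P\<^sub>T\<^sub>'\<close> since \<open>m\<close> is not in \<open>in P\<^sub>T\<^sub>' \<subseteq> P\<^sub>T\<^sub>'(v')\<close>.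

  The facts about \<open>J\<close> and the \<open>P\<^sub>T\<close> behind this argument rest on one principle: nested
  ideals with the same initial monomials are equal (\<open>ideal_eq_if_initial_mons_subset\<close>).

  \<^item> \<open>P\<^sub>T\<close> is the kernel of a monomial map to a polynomial ring, hence prime and homogeneous: a
    monomial divisible by no leading term of a generator of \<open>P\<^sub>T\<close> is the least one in its fibre,
    so it is not an initial monomial of the kernel (\<open>minors_ideal_conv_kernel\<close>).

  \<^item> \<open>J\<close> is the intersection of the \<open>P\<^sub>T\<close>, and \<open>in J\<close> is the intersection of the \<open>in P\<^sub>T\<close>: if
    \<open>x\<^sub>i y\<^sub>j\<close> with \<open>i < j\<close> divides \<open>m\<close>, and \<open>i\<close> and \<open>j\<close> are joined by a path through the support of
    \<open>m\<close>, then \<open>m\<close> is an initial monomial of \<open>J\<close>; if there is no such pair, then removing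
    vertices from the complement of the support as long as possible leads to a cutset \<open>T\<close> with
    \<open>m\<close> outside \<open>in P\<^sub>T\<close> (\<open>binomial_edge_ideal_conv_Inter\<close>).
\<close>


section \<open>Ideals and initial monomials\<close>

lemma module_times: "module ((*) :: 'a::comm_ring_1 \<Rightarrow> 'a \<Rightarrow> 'a)"
  by unfold_locales (auto simp: algebra_simps)

lemma is_ideal_iff:
  "is_ideal I \<longleftrightarrow> 0 \<in> I \<and> (\<forall>a\<in>I. \<forall>b\<in>I. a + b \<in> I) \<and> (\<forall>c. \<forall>a\<in>I. c * a \<in> I)"
  unfolding is_ideal_def module.subspace_def[OF module_times] ..

lemma ideal_zero: "is_ideal I \<Longrightarrow> 0 \<in> I"
  and ideal_add: "is_ideal I \<Longrightarrow> a \<in> I \<Longrightarrow> b \<in> I \<Longrightarrow> a + b \<in> I"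
  and ideal_mult: "is_ideal I \<Longrightarrow> a \<in> I \<Longrightarrow> c * a \<in> I"
  by (auto simp: is_ideal_iff)

lemma ideal_mult_right: "is_ideal I \<Longrightarrow> a \<in> I \<Longrightarrow> a * c \<in> I"
  using ideal_mult[of I a c] by (simp add: mult.commute)

lemma ideal_diff: "is_ideal I \<Longrightarrow> a \<in> I \<Longrightarrow> b \<in> I \<Longrightarrow> a - b \<in> I"
  using ideal_add[of I a "(- 1) * b"] ideal_mult[of I b "- 1"] by simp

lemma ideal_uminus: "is_ideal I \<Longrightarrow> a \<in> I \<Longrightarrow> - a \<in> I"
  using ideal_mult[of I a "- 1"] by simp

lemma ideal_sum: "is_ideal I \<Longrightarrow> (\<And>a. a \<in> A \<Longrightarrow> f a \<in> I) \<Longrightarrow> sum f A \<in> I"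
  by (induction A rule: infinite_finite_induct) (auto simp: ideal_zero ideal_add)

lemma ideal_Inter: "(\<And>i. i \<in> A \<Longrightarrow> is_ideal (I i)) \<Longrightarrow> is_ideal (\<Inter>i\<in>A. I i)"
  by (auto simp: is_ideal_iff)

lemma is_ideal_ideal_gen: "is_ideal (ideal_gen B)"
  unfolding is_ideal_def ideal_gen_def by (rule module.subspace_span[OF module_times])

lemma ideal_gen_base: "b \<in> B \<Longrightarrow> b \<in> ideal_gen B"
  unfolding ideal_gen_def by (rule module.span_base[OF module_times])

lemma ideal_gen_least: "is_ideal I \<Longrightarrow> B \<subseteq> I \<Longrightarrow> ideal_gen B \<subseteq> I"
  unfolding is_ideal_def ideal_gen_def by (metis module.span_minimal[OF module_times])

lemma prime_imp_ideal: "is_prime_ideal P \<Longrightarrow> is_ideal P"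
  by (simp add: is_prime_ideal_def)

lemma poly_mapping_sum_monomials:
  "(\<Sum>m\<in>Poly_Mapping.keys f. Poly_Mapping.single m (Poly_Mapping.lookup f m)) = f"
  by (rule poly_mapping_eqI)
     (auto simp: lookup_sum lookup_single when_def in_keys_iff sum.delta)

lemma poly_mapping_mult_monomials:
  fixes f g :: "'a::comm_monoid_add \<Rightarrow>\<^sub>0 'b::comm_semiring_1"
  shows "f * g = (\<Sum>a\<in>Poly_Mapping.keys f. \<Sum>b\<in>Poly_Mapping.keys g.
      Poly_Mapping.single (a + b) (Poly_Mapping.lookup f a * Poly_Mapping.lookup g b))"
proof -
  have "f * g = (\<Sum>a\<in>Poly_Mapping.keys f. Poly_Mapping.single a (Poly_Mapping.lookup f a)) *
      (\<Sum>b\<in>Poly_Mapping.keys g. Poly_Mapping.single b (Poly_Mapping.lookup g b))"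
    by (simp only: poly_mapping_sum_monomials)
  then show ?thesis
    by (simp only: sum_product mult_single)
qed

lemma keys_single_mult:
  fixes f :: "'a::cancel_comm_monoid_add \<Rightarrow>\<^sub>0 'b::field"
  shows "Poly_Mapping.keys (Poly_Mapping.single a 1 * f) = (+) a ` Poly_Mapping.keys f"
proof
  show "Poly_Mapping.keys (Poly_Mapping.single a 1 * f) \<subseteq> (+) a ` Poly_Mapping.keys f"
    using keys_mult[of "Poly_Mapping.single a 1" f] by auto
  have "Poly_Mapping.single a 1 * f =
      (\<Sum>b\<in>Poly_Mapping.keys f. Poly_Mapping.single (a + b) (Poly_Mapping.lookup f b))"
    by (simp add: poly_mapping_mult_monomials[of "Poly_Mapping.single a 1" f])
  then have "Poly_Mapping.lookup (Poly_Mapping.single a 1 * f) (a + m) = Poly_Mapping.lookup f m" for m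
    by (simp add: lookup_sum lookup_single when_def sum.delta in_keys_iff)
  then show "(+) a ` Poly_Mapping.keys f \<subseteq> Poly_Mapping.keys (Poly_Mapping.single a 1 * f)"
    by (auto simp: in_keys_iff)
qed

lemma mem_monomial_ideal_iff:
  fixes B :: "'a::cancel_comm_monoid_add set" and f :: "'a \<Rightarrow>\<^sub>0 'k::field"
  shows "f \<in> ideal_gen ((\<lambda>m. Poly_Mapping.single m 1) ` B) \<longleftrightarrow>
    (\<forall>m\<in>Poly_Mapping.keys f. \<exists>b\<in>B. \<exists>a. m = a + b)"
    (is "f \<in> ideal_gen ?G \<longleftrightarrow> _")
proof
  let ?M = "{f :: 'a \<Rightarrow>\<^sub>0 'k. \<forall>m\<in>Poly_Mapping.keys f. \<exists>b\<in>B. \<exists>a. m = a + b}"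
  have "is_ideal ?M"
    unfolding is_ideal_iff
  proof (intro conjI ballI allI)
    show "0 \<in> ?M"
      by simp
  next
    fix p q assume "p \<in> ?M" "q \<in> ?M"
    then show "p + q \<in> ?M"
      using keys_add[of p q] by blast
  next
    fix c p assume p: "p \<in> ?M"
    show "c * p \<in> ?M"
    proof clarify
      fix m assume "m \<in> Poly_Mapping.keys (c * p)"
      then obtain a m' where "m = a + m'" "m' \<in> Poly_Mapping.keys p"
        using keys_mult[of c p] by auto
      with p show "\<exists>b\<in>B. \<exists>a. m = a + b"
        by clarsimp (metis add.assoc)
    qed
  qed
  moreover have "?G \<subseteq> ?M"
    by clarsimp (metis add_0)
  ultimately have "ideal_gen ?G \<subseteq> ?M"
    by (rule ideal_gen_least)
  then show "f \<in> ideal_gen ?G \<Longrightarrow> \<forall>m\<in>Poly_Mapping.keys f. \<exists>b\<in>B. \<exists>a. m = a + b"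
    by blast
next
  assume f: "\<forall>m\<in>Poly_Mapping.keys f. \<exists>b\<in>B. \<exists>a. m = a + b"
  have "(\<Sum>m\<in>Poly_Mapping.keys f. Poly_Mapping.single m (Poly_Mapping.lookup f m)) \<in> ideal_gen ?G"
  proof (rule ideal_sum[OF is_ideal_ideal_gen])
    fix m assume "m \<in> Poly_Mapping.keys f"
    with f obtain a b where b: "b \<in> B" "m = a + b"
      by blast
    have "Poly_Mapping.single m (Poly_Mapping.lookup f m) =
        Poly_Mapping.single a (Poly_Mapping.lookup f m) * Poly_Mapping.single b 1"
      by (simp add: mult_single b)
    also have "\<dots> \<in> ideal_gen ?G"
      using b(1) by (intro ideal_mult is_ideal_ideal_gen ideal_gen_base) simp
    finally show "Poly_Mapping.single m (Poly_Mapping.lookup f m) \<in> ideal_gen ?G" .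
  qed
  then show "f \<in> ideal_gen ?G"
    by (simp only: poly_mapping_sum_monomials)
qed

definition initial_mons :: "('n::linorder, 'k::field) bpoly set \<Rightarrow> 'n mon set" where
  "initial_mons I = initial_mon ` (I - {0})"

lemma initial_mon_in_keys: "f \<noteq> 0 \<Longrightarrow> initial_mon f \<in> Poly_Mapping.keys f"
  unfolding initial_mon_def by (rule Max_in) auto

lemma keys_le_initial_mon: "m \<in> Poly_Mapping.keys f \<Longrightarrow> m \<le> initial_mon f"
  unfolding initial_mon_def by (rule Max_ge) auto

lemma initial_mon_eqI:
  "m \<in> Poly_Mapping.keys f \<Longrightarrow> (\<And>m'. m' \<in> Poly_Mapping.keys f \<Longrightarrow> m' \<le> m) \<Longrightarrow> initial_mon f = m"
  unfolding initial_mon_def by (rule Max_eqI) auto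

lemma initial_mons_mono: "I \<subseteq> I' \<Longrightarrow> initial_mons I \<subseteq> initial_mons I'"
  unfolding initial_mons_def by blast

lemma initial_mon_mult:
  fixes f g :: "('n::linorder, 'k::field) bpoly"
  assumes "f \<noteq> 0" "g \<noteq> 0"
  shows "initial_mon (f * g) = initial_mon f + initial_mon g"
proof (rule initial_mon_eqI)
  let ?a = "initial_mon f" and ?b = "initial_mon g"
  have le: "a + b \<le> ?a + ?b" and
    eq: "a + b = ?a + ?b \<longleftrightarrow> a = ?a \<and> b = ?b"
    if "a \<in> Poly_Mapping.keys f" "b \<in> Poly_Mapping.keys g" for a b
  proof -
    have ab: "a \<le> ?a" "b \<le> ?b"
      using that by (auto intro: keys_le_initial_mon)
    then show "a + b \<le> ?a + ?b"
      by (rule add_mono)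
    show "a + b = ?a + ?b \<longleftrightarrow> a = ?a \<and> b = ?b"
      using ab by (metis add_less_le_mono add_le_less_mono order.strict_iff_order)
  qed
  have "Poly_Mapping.lookup (f * g) (?a + ?b) =
      (\<Sum>a\<in>Poly_Mapping.keys f. \<Sum>b\<in>Poly_Mapping.keys g.
        if a + b = ?a + ?b then Poly_Mapping.lookup f a * Poly_Mapping.lookup g b else 0)"
    by (subst poly_mapping_mult_monomials) (simp add: lookup_sum lookup_single when_def)
  also have "\<dots> = (\<Sum>a\<in>Poly_Mapping.keys f. \<Sum>b\<in>Poly_Mapping.keys g.
        if a = ?a \<and> b = ?b then Poly_Mapping.lookup f a * Poly_Mapping.lookup g b else 0)"
    by (intro sum.cong refl) (simp add: eq)
  also have "\<dots> = (\<Sum>a\<in>Poly_Mapping.keys f. if a = ?a then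
        (\<Sum>b\<in>Poly_Mapping.keys g. if b = ?b then Poly_Mapping.lookup f a * Poly_Mapping.lookup g b else 0)
        else 0)"
    by (intro sum.cong refl) auto
  also have "\<dots> = Poly_Mapping.lookup f ?a * Poly_Mapping.lookup g ?b"
    using assms initial_mon_in_keys[of f] initial_mon_in_keys[of g] by simp
  also have "\<dots> \<noteq> 0"
    using assms initial_mon_in_keys[of f] initial_mon_in_keys[of g] by (simp add: in_keys_iff)
  finally show "?a + ?b \<in> Poly_Mapping.keys (f * g)"
    by (simp add: in_keys_iff)
  show "m \<le> ?a + ?b" if "m \<in> Poly_Mapping.keys (f * g)" for m
    using that keys_mult[of f g] le by auto
qed

lemma initial_mons_add:
  fixes I :: "('n::linorder, 'k::field) bpoly set"
  assumes "is_ideal I" "m \<in> initial_mons I"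
  shows "a + m \<in> initial_mons I"
proof -
  from assms(2) obtain f where f: "f \<in> I" "f \<noteq> 0" "m = initial_mon f"
    by (auto simp: initial_mons_def)
  let ?s = "Poly_Mapping.single a 1 :: ('n, 'k) bpoly"
  have s: "?s \<noteq> 0" "initial_mon ?s = a"
    by (auto simp: initial_mon_def poly_mapping_eq_iff fun_eq_iff lookup_single when_def)
  have "initial_mon (?s * f) = a + m"
    by (simp only: initial_mon_mult[OF s(1) f(2)] s(2) f(3))
  moreover have "?s * f \<in> I" "?s * f \<noteq> 0"
    using f s(1) ideal_mult[OF assms(1)] by auto
  ultimately show ?thesis
    by (force simp: initial_mons_def)
qed

text \<open>
  For an ideal the set of initial monomials is already closed under multiplication by monomials,
  so membership in the initial ideal can be tested term by term.
\<close>

lemma mem_initial_ideal_iff: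
  fixes I :: "('n::linorder, 'k::field) bpoly set"
  assumes "is_ideal I"
  shows "f \<in> initial_ideal I \<longleftrightarrow> Poly_Mapping.keys f \<subseteq> initial_mons I"
proof -
  have "{Poly_Mapping.single (initial_mon f) 1 | f. f \<in> I \<and> f \<noteq> 0} =
      (\<lambda>m. Poly_Mapping.single m 1 :: ('n, 'k) bpoly) ` initial_mons I"
    by (auto simp: initial_mons_def)
  then have "f \<in> initial_ideal I \<longleftrightarrow>
      (\<forall>m\<in>Poly_Mapping.keys f. \<exists>b\<in>initial_mons I. \<exists>a. m = a + b)"
    unfolding initial_ideal_def using mem_monomial_ideal_iff[of f "initial_mons I"] by simp
  also have "\<dots> \<longleftrightarrow> (\<forall>m\<in>Poly_Mapping.keys f. m \<in> initial_mons I)"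
    using initial_mons_add[OF assms] by (metis add_0)
  finally show ?thesis
    by blast
qed

instance var :: (finite) finite
proof
  have "u \<in> Set.range X \<union> Set.range Y" for u :: "'a var"
    by (cases u) auto
  then have "(UNIV :: 'a var set) \<subseteq> Set.range X \<union> Set.range Y"
    by blast
  then show "finite (UNIV :: 'a var set)"
    by (rule finite_subset) simp
qed

text \<open>
  As there are finitely many variables, comparing exponent vectors is the lexicographic comparison
  of lists of a fixed length.
\<close>

lemma wf_mon_less: "wfp ((<) :: ('n::{finite,linorder}) mon \<Rightarrow> 'n mon \<Rightarrow> bool)"
proof -
  define L where "L = sorted_list_of_set (UNIV :: 'n var set)"
  have "{(m, m'). m < m'} \<subseteq>
      inv_image (lex less_than) (\<lambda>m :: 'n mon. map (Poly_Mapping.lookup m) L)"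
  proof clarify
    fix m m' :: "'n mon" assume "m < m'"
    then obtain u where u: "Poly_Mapping.lookup m u < Poly_Mapping.lookup m' u"
      "\<And>w. w < u \<Longrightarrow> Poly_Mapping.lookup m w = Poly_Mapping.lookup m' w"
      by (auto simp: monomial_less_iff)
    have "u \<in> set L"
      by (simp add: L_def)
    then obtain p q where L: "L = p @ u # q"
      by (meson split_list)
    have "sorted_wrt (<) L"
      by (simp add: L_def)
    then have "map (Poly_Mapping.lookup m) p = map (Poly_Mapping.lookup m') p"
      by (auto simp: L sorted_wrt_append u(2))
    then show "(m, m') \<in> inv_image (lex less_than) (\<lambda>m. map (Poly_Mapping.lookup m) L)"
      using u(1) unfolding in_inv_image lex_conv mem_Collect_eq case_prod_conv
      by (intro conjI exI[of _ "map (Poly_Mapping.lookup m') p"]) (auto simp: L)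
  qed
  then show ?thesis
    unfolding wfp_def by (rule wf_subset[OF wf_inv_image[OF wf_lex[OF wf_less_than]]])
qed

text \<open>
  Division by the smaller ideal: subtracting a multiple of an element with the same initial
  monomial lowers the initial monomial, and this descent must stop at \<open>0\<close>.
\<close>

lemma ideal_eq_if_initial_mons_subset:
  fixes I K :: "('n::{finite,linorder}, 'k::field) bpoly set"
  assumes "is_ideal I" "is_ideal K" "I \<subseteq> K" and sub: "initial_mons K \<subseteq> initial_mons I"
  shows "I = K"
proof -
  have "f \<noteq> 0 \<Longrightarrow> f \<in> K \<Longrightarrow> initial_mon f = m \<Longrightarrow> f \<in> I" for m f
  proof (induction m arbitrary: f rule: wfp_induct_rule[OF wf_mon_less])
    case (1 m)
    have "m \<in> initial_mons I"
      using 1 sub by (auto simp: initial_mons_def)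
    then obtain g where g: "g \<in> I" "g \<noteq> 0" "initial_mon g = m"
      by (auto simp: initial_mons_def)
    let ?c = "Poly_Mapping.lookup f m / Poly_Mapping.lookup g m"
    define h where "h = f - Poly_Mapping.single 0 ?c * g"
    have cg: "Poly_Mapping.single 0 ?c * g \<in> I"
      using g by (intro ideal_mult assms)
    then have hK: "h \<in> K"
      unfolding h_def using 1 assms by (intro ideal_diff) auto
    have look: "Poly_Mapping.lookup h k = Poly_Mapping.lookup f k - ?c * Poly_Mapping.lookup g k" for k
    proof -
      have "Poly_Mapping.lookup (Poly_Mapping.single 0 ?c * g) k = ?c * Poly_Mapping.lookup g k"
        by (subst mult_map_scale_conv_mult[symmetric]) (simp add: Poly_Mapping.map.rep_eq when_def)
      then show ?thesis
        by (simp add: h_def lookup_minus)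
    qed
    have "Poly_Mapping.lookup g m \<noteq> 0"
      using g initial_mon_in_keys by (auto simp: in_keys_iff)
    then have "m \<notin> Poly_Mapping.keys h"
      by (simp add: in_keys_iff look)
    moreover have "k \<le> m" if "k \<in> Poly_Mapping.keys h" for k
    proof -
      from that have "k \<in> Poly_Mapping.keys f \<or> k \<in> Poly_Mapping.keys g"
        by (auto simp: in_keys_iff look)
      then show "k \<le> m"
        using keys_le_initial_mon[of k f] keys_le_initial_mon[of k g] 1(4) g(3) by auto
    qed
    ultimately have "h \<in> I"
      using "1.IH" hK initial_mon_in_keys[of h] ideal_zero[OF assms(1)]
      by (metis order.not_eq_order_implies_strict)
    then have "h + Poly_Mapping.single 0 ?c * g \<in> I"
      using cg by (rule ideal_add[OF assms(1)])
    then show ?case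
      by (simp add: h_def)
  qed
  then have "f \<in> I" if "f \<in> K" for f
    using that ideal_zero[OF assms(1)] by (cases "f = 0") auto
  then show ?thesis
    using assms(3) by blast
qed


section \<open>Monomial maps\<close>

text \<open>
  The linear extension of a monomial map that sends the monomials outside \<open>A\<close> to \<open>0\<close>. For a face
  \<open>A\<close> of the monoid and an additive \<open>\<phi>\<close> it is a ring homomorphism; typically \<open>A\<close> consists of the
  monomials that avoid certain variables. For \<open>\<phi>\<close> the identity it restricts a polynomial to its
  terms in \<open>A\<close>.
\<close>

definition push_forward ::
    "'a set \<Rightarrow> ('a \<Rightarrow> 'b) \<Rightarrow> ('a \<Rightarrow>\<^sub>0 'k::field) \<Rightarrow> ('b \<Rightarrow>\<^sub>0 'k)" where
  "push_forward A \<phi> f =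
     (\<Sum>m\<in>Poly_Mapping.keys f. if m \<in> A then Poly_Mapping.single (\<phi> m) (Poly_Mapping.lookup f m) else 0)"

definition is_face :: "'a::monoid_add set \<Rightarrow> bool" where
  "is_face A \<longleftrightarrow> 0 \<in> A \<and> (\<forall>a b. a + b \<in> A \<longleftrightarrow> a \<in> A \<and> b \<in> A)"

lemma push_forward_superset:
  assumes "finite K" "Poly_Mapping.keys f \<subseteq> K"
  shows "push_forward A \<phi> f =
     (\<Sum>m\<in>K. if m \<in> A then Poly_Mapping.single (\<phi> m) (Poly_Mapping.lookup f m) else 0)"
  unfolding push_forward_def
  by (rule sum.mono_neutral_left) (use assms in \<open>auto simp: in_keys_iff\<close>)

lemma push_forward_add: "push_forward A \<phi> (f + g) = push_forward A \<phi> f + push_forward A \<phi> g"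
proof -
  let ?K = "Poly_Mapping.keys f \<union> Poly_Mapping.keys g"
  have K: "finite ?K" "Poly_Mapping.keys f \<subseteq> ?K" "Poly_Mapping.keys g \<subseteq> ?K"
      "Poly_Mapping.keys (f + g) \<subseteq> ?K"
    using keys_add[of f g] by auto
  show ?thesis
    unfolding push_forward_superset[OF K(1,2)] push_forward_superset[OF K(1,3)]
      push_forward_superset[OF K(1,4)] sum.distrib[symmetric]
    by (rule sum.cong) (auto simp: lookup_add single_add)
qed

lemma push_forward_single:
  "push_forward A \<phi> (Poly_Mapping.single m c) = (if m \<in> A then Poly_Mapping.single (\<phi> m) c else 0)"
  by (subst push_forward_superset[of "{m}"]) auto

lemma push_forward_zero [simp]: "push_forward A \<phi> 0 = 0"
  by (simp add: push_forward_def)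

lemma push_forward_sum: "push_forward A \<phi> (sum F I) = (\<Sum>i\<in>I. push_forward A \<phi> (F i))"
  by (induction I rule: infinite_finite_induct) (simp_all add: push_forward_add)

lemma lookup_push_forward:
  "Poly_Mapping.lookup (push_forward A \<phi> f) b =
     (\<Sum>m | m \<in> Poly_Mapping.keys f \<and> m \<in> A \<and> \<phi> m = b. Poly_Mapping.lookup f m)"
proof -
  have "Poly_Mapping.lookup (push_forward A \<phi> f) b =
      (\<Sum>m\<in>Poly_Mapping.keys f. if m \<in> A \<and> \<phi> m = b then Poly_Mapping.lookup f m else 0)"
    unfolding push_forward_def lookup_sum
    by (rule sum.cong) (auto simp: lookup_single when_def)
  also have "\<dots> = (\<Sum>m\<in>Poly_Mapping.keys f \<inter> {m. m \<in> A \<and> \<phi> m = b}. Poly_Mapping.lookup f m)"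
    by (subst sum.inter_restrict) (auto intro: sum.cong)
  finally show ?thesis
    by (simp add: Int_def)
qed

lemma push_forward_mult:
  fixes f g :: "'a::comm_monoid_add \<Rightarrow>\<^sub>0 'k::field" and \<phi> :: "'a \<Rightarrow> 'b::comm_monoid_add"
  assumes "is_face A" and \<phi>: "\<And>a b. \<phi> (a + b) = \<phi> a + \<phi> b"
  shows "push_forward A \<phi> (f * g) = push_forward A \<phi> f * push_forward A \<phi> g"
proof -
  have "push_forward A \<phi> (f * g) =
      (\<Sum>a\<in>Poly_Mapping.keys f. \<Sum>b\<in>Poly_Mapping.keys g. if a + b \<in> A then
        Poly_Mapping.single (\<phi> (a + b)) (Poly_Mapping.lookup f a * Poly_Mapping.lookup g b) else 0)"
    by (subst poly_mapping_mult_monomials) (simp add: push_forward_sum push_forward_single)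
  also have "\<dots> = push_forward A \<phi> f * push_forward A \<phi> g"
    unfolding push_forward_def sum_product
    using assms(1) by (intro sum.cong refl) (auto simp: is_face_def \<phi> mult_single)
  finally show ?thesis .
qed

lemma prime_kernel_push_forward:
  fixes \<phi> :: "'a::comm_monoid_add \<Rightarrow> 'b::{ordered_cancel_comm_monoid_add, linorder}"
  assumes A: "is_face A" and \<phi>: "\<And>a b. \<phi> (a + b) = \<phi> a + \<phi> b" and "\<phi> 0 = 0"
  shows "is_prime_ideal {f :: 'a \<Rightarrow>\<^sub>0 'k::field. push_forward A \<phi> f = 0}"
proof -
  have "push_forward A \<phi> (1 :: 'a \<Rightarrow>\<^sub>0 'k) = 1"
    using push_forward_single[of A \<phi> 0 "1 :: 'k"] A assms(3) by (simp add: is_face_def)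
  then have "(1 :: 'a \<Rightarrow>\<^sub>0 'k) \<notin> {f. push_forward A \<phi> f = 0}"
    by simp
  then have "{f :: 'a \<Rightarrow>\<^sub>0 'k. push_forward A \<phi> f = 0} \<noteq> UNIV"
    by blast
  then show ?thesis
    unfolding is_prime_ideal_def is_ideal_iff
    by (auto simp: push_forward_add push_forward_mult[OF A \<phi>])
qed

lemma lookup_restrict:
  "Poly_Mapping.lookup (push_forward A (\<lambda>m. m) f) m = (if m \<in> A then Poly_Mapping.lookup f m else 0)"
proof -
  have "{k. k \<in> Poly_Mapping.keys f \<and> k \<in> A \<and> k = m} = (if m \<in> A \<and> m \<in> Poly_Mapping.keys f then {m} else {})"
    by auto
  then show ?thesis
    by (auto simp: lookup_push_forward in_keys_iff)
qed

lemma keys_restrict: "Poly_Mapping.keys (push_forward A (\<lambda>m. m) f) = Poly_Mapping.keys f \<inter> A"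
  by (auto simp: in_keys_iff lookup_restrict split: if_splits)

text \<open>
  A grading \<open>D\<close> of the target makes the kernel homogeneous for the induced grading of the source,
  because each fibre lies in a single degree.
\<close>

lemma push_forward_restrict_fibres:
  assumes "push_forward A \<phi> f = 0"
  shows "push_forward A \<phi> (push_forward {m. D (\<phi> m) = d} (\<lambda>m. m) f) = 0"
proof (rule poly_mapping_eqI)
  fix b
  have "{m. m \<in> Poly_Mapping.keys f \<inter> {m. D (\<phi> m) = d} \<and> m \<in> A \<and> \<phi> m = b} =
      (if D b = d then {m. m \<in> Poly_Mapping.keys f \<and> m \<in> A \<and> \<phi> m = b} else {})"
    by auto
  moreover have "(\<Sum>m | m \<in> Poly_Mapping.keys f \<and> m \<in> A \<and> \<phi> m = b. Poly_Mapping.lookup f m) = 0"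
    using assms lookup_push_forward[of A \<phi> f b] by simp
  ultimately show "Poly_Mapping.lookup (push_forward A \<phi> (push_forward {m. D (\<phi> m) = d} (\<lambda>m. m) f)) b =
      Poly_Mapping.lookup 0 b"
    unfolding lookup_push_forward[of A] keys_restrict
    by (auto simp: lookup_restrict intro!: trans[OF sum.cong])
qed


section \<open>The ideals of two-minors attached to a labelling\<close>

definition mon_support :: "'n mon \<Rightarrow> 'n set" where
  "mon_support m = {i. Poly_Mapping.lookup m (X i) \<noteq> 0 \<or> Poly_Mapping.lookup m (Y i) \<noteq> 0}"

lemma mon_support_add: "mon_support (a + b) = mon_support a \<union> mon_support b"
  by (auto simp: mon_support_def lookup_add)

lemma is_face_avoiding: "is_face {m. mon_support m \<inter> T = {}}"
  by (auto simp: is_face_def mon_support_add) (simp add: mon_support_def)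

definition mon_of :: "('n::finite var \<Rightarrow> nat) \<Rightarrow> 'n mon" where
  "mon_of h = Poly_Mapping.Abs_poly_mapping h"

lemma lookup_mon_of [simp]: "Poly_Mapping.lookup (mon_of h) u = h u"
  by (simp add: mon_of_def)

text \<open>
  The exponent map of the substitution \<open>x\<^sub>i \<mapsto> z\<^sub>i s\<^sub>r\<^sub>(\<^sub>i\<^sub>)\<close>, \<open>y\<^sub>i \<mapsto> z\<^sub>i\<close>, where the target
  indeterminates \<open>z\<^sub>i\<close> and \<open>s\<^sub>c\<close> are again called \<open>X i\<close> and \<open>Y c\<close>. It parametrises, for each label
  \<open>c\<close>, the two-row matrices of rank one with columns the vertices labelled \<open>c\<close>; normalising the
  parameter of the second row to \<open>1\<close> does not change the kernel.
\<close>

definition segre :: "('n \<Rightarrow> 'n) \<Rightarrow> ('n::finite) mon \<Rightarrow> 'n mon" where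
  "segre r m = mon_of (\<lambda>u. case u of
      X i \<Rightarrow> Poly_Mapping.lookup m (X i) + Poly_Mapping.lookup m (Y i)
    | Y c \<Rightarrow> \<Sum>i | r i = c. Poly_Mapping.lookup m (X i))"

lemma lookup_segre [simp]:
  "Poly_Mapping.lookup (segre r m) (X i) = Poly_Mapping.lookup m (X i) + Poly_Mapping.lookup m (Y i)"
  "Poly_Mapping.lookup (segre r m) (Y c) = (\<Sum>i | r i = c. Poly_Mapping.lookup m (X i))"
  by (simp_all add: segre_def)

lemma mon_eqI:
  assumes "\<And>i. Poly_Mapping.lookup m (X i) = Poly_Mapping.lookup m' (X i)"
    and "\<And>i. Poly_Mapping.lookup m (Y i) = Poly_Mapping.lookup m' (Y i)"
  shows "m = m'"
proof (rule poly_mapping_eqI)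
  fix u show "Poly_Mapping.lookup m u = Poly_Mapping.lookup m' u"
    by (cases u) (simp_all add: assms)
qed

lemma segre_add: "segre r (a + b) = segre r a + segre r b"
  by (rule mon_eqI) (simp_all add: lookup_add sum.distrib)

lemma segre_zero: "segre r 0 = 0"
  by (rule mon_eqI) simp_all

lemma mon_degree_conv_segre:
  "mon_degree m = (\<Sum>i\<in>UNIV. Poly_Mapping.lookup (segre r m) (X i))"
proof -
  have U: "(UNIV :: 'a var set) = X ` UNIV \<union> Y ` UNIV"
  proof -
    have "u \<in> X ` UNIV \<union> Y ` UNIV" for u :: "'a var"
      by (cases u) auto
    then show ?thesis
      by blast
  qed
  have "mon_degree m = (\<Sum>u\<in>UNIV. Poly_Mapping.lookup m u)"
    unfolding mon_degree_def by (rule sum.mono_neutral_left) (auto simp: in_keys_iff)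
  also have "\<dots> = (\<Sum>u\<in>X ` UNIV. Poly_Mapping.lookup m u) + (\<Sum>u\<in>Y ` UNIV. Poly_Mapping.lookup m u)"
    unfolding U by (rule sum.union_disjoint) auto
  also have "\<dots> = (\<Sum>i\<in>UNIV. Poly_Mapping.lookup (segre r m) (X i))"
    by (simp add: sum.reindex inj_on_def sum.distrib)
  finally show ?thesis .
qed

text \<open>
  \<^const>\<open>cutset_prime\<close> with the components replaced by the classes of a labelling \<open>r\<close>, so that
  \<^const>\<open>segre\<close> can refer to labels.
\<close>

definition minors_ideal :: "'n set \<Rightarrow> ('n \<Rightarrow> 'n) \<Rightarrow> ('n::linorder, 'k::field) bpoly set" where
  "minors_ideal T r = ideal_gen
     ({indet (X i) | i. i \<in> T} \<union> {indet (Y i) | i. i \<in> T} \<union>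
      {edge_binomial i j | i j. i < j \<and> i \<notin> T \<and> j \<notin> T \<and> r i = r j})"

text \<open>
  The monomials that no \<open>x\<^sub>i\<close>, \<open>y\<^sub>i\<close> with \<open>i \<in> T\<close> and no leading term \<open>x\<^sub>i y\<^sub>j\<close> of a minor divides,
  \<open>i\<close> and \<open>j\<close> being columns of the same block when \<open>R i j\<close>.
\<close>

definition standard_mon :: "('n::linorder \<Rightarrow> 'n \<Rightarrow> bool) \<Rightarrow> 'n set \<Rightarrow> 'n mon \<Rightarrow> bool" where
  "standard_mon R T m \<longleftrightarrow> mon_support m \<inter> T = {} \<and>
     (\<forall>i j. i < j \<and> R i j \<longrightarrow>
       Poly_Mapping.lookup m (X i) = 0 \<or> Poly_Mapping.lookup m (Y j) = 0)"

text \<open>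
  A fibre fixes the content \<open>x\<^sub>i y\<^sub>i\<close> of every column and the number of \<open>x\<close>'s in every block. If
  \<open>m' < m\<close> in a fibre, the first difference takes an \<open>x\<^sub>i\<close> away from \<open>m\<close>, which has to reappear as
  an \<open>x\<^sub>j\<close> with \<open>j > i\<close> in the same block, replacing a \<open>y\<^sub>j\<close> of \<open>m\<close>. Then \<open>x\<^sub>i y\<^sub>j\<close> divides \<open>m\<close>.
\<close>

lemma standard_mon_le_in_fibre:
  fixes m m' :: "('n::{finite,linorder}) mon"
  assumes std: "standard_mon (\<lambda>i j. r i = r j) T m"
    and eq: "segre r m' = segre r m"
  shows "m \<le> m'"
proof (rule ccontr)
  assume "\<not> m \<le> m'"
  then have "m' < m"
    by simp
  then obtain u where u: "Poly_Mapping.lookup m' u < Poly_Mapping.lookup m u"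
    and before: "\<And>w. w < u \<Longrightarrow> Poly_Mapping.lookup m' w = Poly_Mapping.lookup m w"
    by (auto simp: monomial_less_iff)
  have row: "Poly_Mapping.lookup m' (X i) + Poly_Mapping.lookup m' (Y i) =
      Poly_Mapping.lookup m (X i) + Poly_Mapping.lookup m (Y i)" for i
    using lookup_segre(1)[of r m i] lookup_segre(1)[of r m' i] eq by simp
  show False
  proof (cases u)
    case (X i)
    have before': "Poly_Mapping.lookup m' (X k) = Poly_Mapping.lookup m (X k)" if "k < i" for k
      using before[of "X k"] that by (simp add: X less_var_def less_le_not_le)
    have "(\<Sum>k | r k = r i. Poly_Mapping.lookup m' (X k)) = (\<Sum>k | r k = r i. Poly_Mapping.lookup m (X k))"
      using lookup_segre(2)[of r m "r i"] lookup_segre(2)[of r m' "r i"] eq by simp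
    moreover have "(\<Sum>k | r k = r i. Poly_Mapping.lookup m' (X k)) < (\<Sum>k | r k = r i. Poly_Mapping.lookup m (X k))"
      if "\<And>k. r k = r i \<Longrightarrow> Poly_Mapping.lookup m' (X k) \<le> Poly_Mapping.lookup m (X k)"
      using that u by (intro sum_strict_mono_ex1) (auto simp: X)
    ultimately obtain j where j: "r j = r i" "Poly_Mapping.lookup m (X j) < Poly_Mapping.lookup m' (X j)"
      by (metis less_irrefl not_le)
    then have "i < j"
      using before'[of j] u X by (metis less_irrefl not_less_iff_gr_or_eq order.asym)
    moreover have "Poly_Mapping.lookup m (Y j) \<noteq> 0"
      using row[of j] j(2) by simp
    moreover have "Poly_Mapping.lookup m (X i) \<noteq> 0"
      using u X by simp
    ultimately show False
      using std j(1) unfolding standard_mon_def by metis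
  next
    case (Y i)
    have "Poly_Mapping.lookup m' (X i) = Poly_Mapping.lookup m (X i)"
      using before[of "X i"] by (simp add: Y less_var_def)
    then show False
      using row[of i] u Y by simp
  qed
qed

lemma indet_neq_zero: "indet u \<noteq> 0"
  unfolding indet_def by (metis lookup_single_eq lookup_zero zero_neq_one)

lemma keys_indet [simp]: "Poly_Mapping.keys (indet u :: ('n, 'k::field) bpoly) = {Poly_Mapping.single u 1}"
  by (simp add: indet_def)

lemma initial_mon_indet [simp]:
  "initial_mon (indet u :: ('n::linorder, 'k::field) bpoly) = Poly_Mapping.single u 1"
  by (simp add: initial_mon_def)

abbreviation xy_mon :: "'n \<Rightarrow> 'n \<Rightarrow> 'n mon" where
  "xy_mon i j \<equiv> Poly_Mapping.single (X i) 1 + Poly_Mapping.single (Y j) 1"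

lemma edge_binomial_conv:
  "edge_binomial i j = Poly_Mapping.single (xy_mon i j) 1 - Poly_Mapping.single (xy_mon j i) 1"
  by (simp add: edge_binomial_def indet_def mult_single)

lemma initial_mon_edge_binomial:
  fixes i j :: "'n::linorder"
  assumes "i < j"
  shows "edge_binomial i j \<noteq> (0 :: ('n, 'k::field) bpoly)"
    and "initial_mon (edge_binomial i j :: ('n, 'k) bpoly) = xy_mon i j"
proof -
  have less: "xy_mon j i < xy_mon i j"
    unfolding monomial_less_iff
    by (rule exI[of _ "X i"])
       (use assms in \<open>auto simp: lookup_add lookup_single when_def less_var_def\<close>)
  have look: "Poly_Mapping.lookup (edge_binomial i j :: ('n, 'k) bpoly) m =
      (if m = xy_mon i j then 1 else if m = xy_mon j i then - 1 else 0)" for m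
    using less by (auto simp: edge_binomial_conv lookup_minus lookup_single when_def)
  then have keys: "Poly_Mapping.keys (edge_binomial i j :: ('n, 'k) bpoly) = {xy_mon i j, xy_mon j i}"
    by (auto simp: in_keys_iff split: if_splits)
  then show "edge_binomial i j \<noteq> (0 :: ('n, 'k) bpoly)"
    by auto
  show "initial_mon (edge_binomial i j :: ('n, 'k) bpoly) = xy_mon i j"
    using less by (intro initial_mon_eqI) (auto simp: keys)
qed

lemma initial_mons_factor:
  fixes I :: "('n::linorder, 'k::field) bpoly set"
  assumes "is_ideal I" "f \<in> I" "f \<noteq> 0"
    and le: "\<And>u. Poly_Mapping.lookup (initial_mon f) u \<le> Poly_Mapping.lookup m u"
  shows "m \<in> initial_mons I"
proof -
  have "m = (m - initial_mon f) + initial_mon f"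
    using le by (intro poly_mapping_eqI) (simp add: lookup_add lookup_minus)
  moreover have "initial_mon f \<in> initial_mons I"
    using assms by (auto simp: initial_mons_def)
  ultimately show ?thesis
    using initial_mons_add[OF assms(1)] by metis
qed

text \<open>
  If the initial monomial of an element of the kernel were standard, it would be the only term of
  that element in its fibre, and the coefficient of its image would not cancel. So the kernel has
  nonstandard initial monomials only, and all of these already occur in the ideal of minors.
\<close>

lemma
  fixes T :: "'n::{finite,linorder} set"
  shows minors_ideal_conv_kernel: "(minors_ideal T r :: ('n, 'k::field) bpoly set) =
      {f. push_forward {m. mon_support m \<inter> T = {}} (segre r) f = 0}" (is "?P = ?K")
    and initial_mons_minors_ideal: "initial_mons (minors_ideal T r :: ('n, 'k) bpoly set) =
      {m. \<not> standard_mon (\<lambda>i j. r i = r j) T m}"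
proof -
  let ?A = "{m :: 'n mon. mon_support m \<inter> T = {}}"
  let ?N = "{m. \<not> standard_mon (\<lambda>i j. r i = r j) T m}"
  have ideals: "is_ideal ?P" "is_ideal ?K"
    unfolding minors_ideal_def
    by (rule is_ideal_ideal_gen)
       (rule prime_imp_ideal[OF prime_kernel_push_forward[OF is_face_avoiding segre_add segre_zero]])
  have "segre r (xy_mon i j) = segre r (xy_mon j i)" if "r i = r j" for i j
    by (rule mon_eqI)
       (auto simp: lookup_add lookup_single when_def that)
  moreover have sup: "mon_support (xy_mon i j) = mon_support (xy_mon j i)" for i j :: 'n
    by (auto simp: mon_support_def lookup_add lookup_single when_def)
  ultimately have "edge_binomial i j \<in> ?K" if "r i = r j" for i j
    using that sup[of i j]
    by (simp add: edge_binomial_conv diff_conv_add_uminus push_forward_add push_forward_single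
        del: add_uminus_conv_diff flip: single_uminus)
       (simp add: single_uminus)
  moreover have "indet (X i) \<in> ?K" "indet (Y i) \<in> ?K" if "i \<in> T" for i
    using that by (auto simp: indet_def push_forward_single mon_support_def lookup_single when_def)
  ultimately have sub: "?P \<subseteq> ?K"
    unfolding minors_ideal_def
    by (intro ideal_gen_least ideals) blast
  have K: "initial_mons ?K \<subseteq> ?N"
  proof
    fix m assume "m \<in> initial_mons ?K"
    then obtain f :: "('n, 'k) bpoly"
      where f: "f \<noteq> 0" "push_forward ?A (segre r) f = 0" "m = initial_mon f"
      by (auto simp: initial_mons_def)
    show "m \<in> ?N"
    proof (rule ccontr)
      assume "m \<notin> ?N"
      then have std: "standard_mon (\<lambda>i j. r i = r j) T m"
        by simp
      have "{k. k \<in> Poly_Mapping.keys f \<and> k \<in> ?A \<and> segre r k = segre r m} = {m}"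
        using f std standard_mon_le_in_fibre[OF std] keys_le_initial_mon[of _ f] initial_mon_in_keys[OF f(1)]
        by (auto simp: standard_mon_def intro: antisym)
      then have "Poly_Mapping.lookup f m = 0"
        using lookup_push_forward[of ?A "segre r" f "segre r m"] f(2) by simp
      then show False
        using initial_mon_in_keys[OF f(1)] f(3) by (simp add: in_keys_iff)
    qed
  qed
  have N: "?N \<subseteq> initial_mons ?P"
  proof
    fix m assume "m \<in> ?N"
    then consider
        (var) i where "i \<in> T" "i \<in> mon_support m"
      | (pair) i j where "mon_support m \<inter> T = {}" "i < j" "r i = r j"
          "Poly_Mapping.lookup m (X i) \<noteq> 0" "Poly_Mapping.lookup m (Y j) \<noteq> 0"
      by (auto simp: standard_mon_def)
    then show "m \<in> initial_mons ?P"
    proof cases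
      case var
      then obtain u where u: "u = X i \<or> u = Y i" "Poly_Mapping.lookup m u \<noteq> 0"
        by (auto simp: mon_support_def)
      then have "indet u \<in> ?P"
        using var unfolding minors_ideal_def by (intro ideal_gen_base) auto
      then show ?thesis
        by (rule initial_mons_factor[OF ideals(1) _ indet_neq_zero])
          (use u(2) in \<open>auto simp: lookup_single when_def\<close>)
    next
      case pair
      then have "i \<notin> T" "j \<notin> T"
        by (auto simp: mon_support_def)
      then have "edge_binomial i j \<in> ?P"
        using pair unfolding minors_ideal_def by (intro ideal_gen_base) blast
      then show ?thesis
        by (rule initial_mons_factor[OF ideals(1)])
           (use pair in \<open>auto simp: initial_mon_edge_binomial lookup_add lookup_single when_def\<close>)
    qed
  qed
  show "?P = ?K"
    using ideals sub K N by (intro ideal_eq_if_initial_mons_subset) auto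
  with K N show "initial_mons ?P = ?N"
    by auto
qed

lemma prime_minors_ideal:
  "is_prime_ideal (minors_ideal T r :: ('n::{finite,linorder}, 'k::field) bpoly set)"
  unfolding minors_ideal_conv_kernel
  by (rule prime_kernel_push_forward[OF is_face_avoiding segre_add segre_zero])

definition homogeneous_component :: "nat \<Rightarrow> ('n, 'k::field) bpoly \<Rightarrow> ('n, 'k) bpoly" where
  "homogeneous_component d = push_forward {m. mon_degree m = d} (\<lambda>m. m)"

lemma homogeneous_component_minors_ideal:
  fixes f :: "('n::{finite,linorder}, 'k::field) bpoly"
  assumes "f \<in> minors_ideal T r"
  shows "homogeneous_component d f \<in> minors_ideal T r"
  using assms push_forward_restrict_fibres[where d = d and f = f and \<phi> = "segre r"
      and D = "\<lambda>m. \<Sum>i\<in>UNIV. Poly_Mapping.lookup m (X i)"]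
  unfolding minors_ideal_conv_kernel homogeneous_component_def mon_degree_conv_segre[of _ r]
  by auto


section \<open>Connectivity and cutsets\<close>

definition linked :: "('n \<times> 'n) set \<Rightarrow> 'n set \<Rightarrow> 'n \<Rightarrow> 'n \<Rightarrow> bool" where
  "linked E W i j \<longleftrightarrow> i \<in> W \<and> j \<in> W \<and> (i, j) \<in> (E \<inter> W \<times> W)\<^sup>*"

definition component_of :: "('n \<times> 'n) set \<Rightarrow> 'n set \<Rightarrow> 'n \<Rightarrow> 'n set" where
  "component_of E W i = {j. linked E W i j}"

lemma linked_refl: "i \<in> W \<Longrightarrow> linked E W i i"
  by (simp add: linked_def)

lemma linked_sym: "sym E \<Longrightarrow> linked E W i j \<Longrightarrow> linked E W j i"
proof -
  assume "sym E" "linked E W i j"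
  moreover have "sym (E \<inter> W \<times> W)"
    using \<open>sym E\<close> by (auto simp: sym_def)
  ultimately show ?thesis
    by (auto simp: linked_def intro: symD[OF sym_rtrancl])
qed

lemma linked_trans: "linked E W i j \<Longrightarrow> linked E W j k \<Longrightarrow> linked E W i k"
  by (auto simp: linked_def)

lemma linked_mono: "linked E W i j \<Longrightarrow> W \<subseteq> W' \<Longrightarrow> linked E W' i j"
  unfolding linked_def using rtrancl_mono[of "E \<inter> W \<times> W" "E \<inter> W' \<times> W'"] by blast

lemma linked_edge: "(i, j) \<in> E \<Longrightarrow> i \<in> W \<Longrightarrow> j \<in> W \<Longrightarrow> linked E W i j"
  by (auto simp: linked_def)

lemma components_on_conv: "components_on E W = component_of E W ` W"
  by (auto simp: components_on_def quotient_def component_of_def linked_def)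

lemma component_of_eq_iff:
  assumes "sym E" "i \<in> W" "j \<in> W"
  shows "component_of E W i = component_of E W j \<longleftrightarrow> linked E W i j"
proof
  assume "component_of E W i = component_of E W j"
  then show "linked E W i j"
    using linked_refl[OF assms(3), of E] by (auto simp: component_of_def)
next
  assume ij: "linked E W i j"
  then have "linked E W j i"
    by (rule linked_sym[OF assms(1)])
  with ij show "component_of E W i = component_of E W j"
    by (auto simp: component_of_def intro: linked_trans)
qed

lemma in_component_of: "i \<in> W \<Longrightarrow> i \<in> component_of E W i"
  by (simp add: component_of_def linked_refl)

lemma component_unique:
  assumes "sym E" "C \<in> components_on E W" "i \<in> C"
  shows "i \<in> W" "C = component_of E W i"
proof -
  from assms(2) obtain j where j: "j \<in> W" "C = component_of E W j"
    by (auto simp: components_on_conv)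
  then have "linked E W j i"
    using assms(3) by (simp add: component_of_def)
  then show "i \<in> W" "C = component_of E W i"
    using j component_of_eq_iff[OF assms(1)] by (auto simp: linked_def)
qed

lemma same_component_iff:
  assumes "sym E"
  shows "(\<exists>C\<in>components_on E W. i \<in> C \<and> j \<in> C) \<longleftrightarrow> linked E W i j"
proof
  assume "\<exists>C\<in>components_on E W. i \<in> C \<and> j \<in> C"
  then show "linked E W i j"
    using component_unique[OF assms] component_of_eq_iff[OF assms] by metis
next
  assume "linked E W i j"
  then show "\<exists>C\<in>components_on E W. i \<in> C \<and> j \<in> C"
    by (intro bexI[of _ "component_of E W i"])
       (auto simp: components_on_conv component_of_def linked_refl, auto simp: linked_def)
qed

lemma linked_insert_not_reaching:
  assumes "linked E (insert t W) i j" "i \<noteq> t" "\<not> linked E (insert t W) i t"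
  shows "linked E W i j"
proof -
  have i: "i \<in> W"
    using assms by (auto simp: linked_def)
  have "(i, j) \<in> (E \<inter> insert t W \<times> insert t W)\<^sup>*"
    using assms by (simp add: linked_def)
  then have "linked E W i j"
  proof (induction rule: rtrancl_induct)
    case base
    show ?case using i by (rule linked_refl)
  next
    case (step j k)
    have "linked E (insert t W) i j"
      using linked_mono[OF step.IH] by blast
    moreover have "linked E (insert t W) j k"
      using step.hyps by (auto intro: linked_edge)
    ultimately have "linked E (insert t W) i k"
      by (rule linked_trans)
    with assms(3) have "k \<noteq> t"
      by blast
    then have "linked E W j k"
      using step by (intro linked_edge) (auto simp: linked_def)
    with step.IH show ?case
      by (rule linked_trans)
  qed
  then show ?thesis .
qed

text \<open>
  Every component of \<open>W\<close> lies in a component of \<open>insert t W\<close>. This map of components fails to be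
  injective exactly if \<open>t\<close> connects two components of \<open>W\<close>, and then it is onto, since \<open>t\<close> is not
  isolated.
\<close>

lemma cut_vertex_iff:
  fixes E :: "('n::finite \<times> 'n) set"
  assumes "sym E" "t \<notin> W"
  shows "cut_vertex_on E (insert t W) t \<longleftrightarrow>
    (\<exists>a\<in>W. \<exists>b\<in>W. linked E (insert t W) a b \<and> \<not> linked E W a b)"
proof -
  let ?W = "insert t W"
  let ?c = "component_of E ?W" and ?d = "component_of E W"
  define h where "h D = (\<Union>i\<in>D. ?c i)" for D
  have hd: "h (?d i) = ?c i" if "i \<in> W" for i
  proof -
    have "?c j = ?c i" if "j \<in> ?d i" for j
    proof -
      have "linked E W i j"
        using that by (simp add: component_of_def)
      then have "linked E ?W i j"
        by (rule linked_mono) blast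
      then show ?thesis
        using component_of_eq_iff[OF assms(1), of i ?W j] by (simp add: linked_def)
    qed
    then have "h (?d i) = (\<Union>j\<in>?d i. ?c i)"
      unfolding h_def by (intro SUP_cong refl)
    also have "\<dots> = ?c i"
      using in_component_of[OF that, of E] by blast
    finally show ?thesis .
  qed
  have comps: "components_on E W = ?d ` W" "components_on E ?W = ?c ` ?W"
    by (simp_all add: components_on_conv)
  have hW: "h ` ?d ` W = ?c ` W"
    using hd by (auto simp: image_image)
  show ?thesis
  proof (cases "\<exists>a\<in>W. \<exists>b\<in>W. linked E ?W a b \<and> \<not> linked E W a b")
    case True
    then obtain a b where ab: "a \<in> W" "b \<in> W" "linked E ?W a b" "\<not> linked E W a b"
      by blast
    then have "linked E ?W a t"
      using linked_insert_not_reaching assms(2) by metis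
    then have "?c a = ?c t"
      using component_of_eq_iff[OF assms(1), of a ?W t] ab by auto
    then have "?c ` ?W = h ` ?d ` W"
      unfolding hW using ab(1) by auto
    moreover have "\<not> inj_on h (?d ` W)"
    proof
      assume "inj_on h (?d ` W)"
      moreover have "h (?d a) = h (?d b)"
        using ab component_of_eq_iff[OF assms(1), of a ?W b] by (simp add: hd)
      ultimately have "?d a = ?d b"
        using ab by (auto dest: inj_onD)
      then show False
        using ab component_of_eq_iff[OF assms(1), of a W b] by simp
    qed
    ultimately have "card (?c ` ?W) < card (?d ` W)"
      by (metis card_image_le eq_card_imp_inj_on finite order.not_eq_order_implies_strict)
    then show ?thesis
      using True assms(2) by (simp add: cut_vertex_on_def comps)
  next
    case False
    have "inj_on h (?d ` W)"
    proof (rule inj_onI, clarify)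
      fix a b assume "a \<in> W" "b \<in> W" "h (?d a) = h (?d b)"
      then show "?d a = ?d b"
        using False by (simp add: hd component_of_eq_iff[OF assms(1)])
    qed
    then have "card (?d ` W) = card (?c ` W)"
      unfolding hW[symmetric] by (rule card_image[symmetric])
    also have "\<dots> \<le> card (?c ` ?W)"
      by (rule card_mono) auto
    finally show ?thesis
      using False assms(2) by (simp add: cut_vertex_on_def comps)
  qed
qed

lemma cutset_iff:
  fixes E :: "('n::finite \<times> 'n) set"
  assumes "sym E"
  shows "T \<in> cutsets E \<longleftrightarrow> (\<forall>t\<in>T. \<exists>a\<in>- T. \<exists>b\<in>- T. linked E (- (T - {t})) a b \<and> \<not> linked E (- T) a b)"
proof -
  have "- (T - {t}) = insert t (- T)" if "t \<in> T" for t
    using that by auto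
  then show ?thesis
    unfolding cutsets_def mem_Collect_eq by (intro ball_cong refl) (simp add: cut_vertex_iff[OF assms])
qed


section \<open>The initial ideal and the decomposition of a binomial edge ideal\<close>

text \<open>
  The monomials outside the initial ideal of \<open>P\<^sub>T\<close>, as shown in \<open>initial_mons_cutset_prime\<close>. The
  definition makes sense for every vertex set \<open>T\<close>; this is used to reach a cutset by shrinking.
\<close>

abbreviation standard_for :: "('n::linorder \<times> 'n) set \<Rightarrow> 'n set \<Rightarrow> 'n mon \<Rightarrow> bool" where
  "standard_for E T \<equiv> standard_mon (linked E (- T)) T"

lemma cutset_prime_conv_minors_ideal:
  assumes "sym E" and r: "\<forall>i j. i \<notin> T \<longrightarrow> j \<notin> T \<longrightarrow> (r i = r j \<longleftrightarrow> linked E (- T) i j)"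
  shows "cutset_prime E T = minors_ideal T r"
proof -
  have "i < j \<and> linked E (- T) i j \<longleftrightarrow> i < j \<and> i \<notin> T \<and> j \<notin> T \<and> r i = r j" for i j
    using r by (auto simp: linked_def)
  then show ?thesis
    by (simp only: cutset_prime_def minors_ideal_def same_component_iff[OF assms(1)])
qed

lemma component_labelling:
  assumes "sym E"
  shows "\<exists>r :: 'n \<Rightarrow> 'n. \<forall>i j. i \<notin> T \<longrightarrow> j \<notin> T \<longrightarrow> (r i = r j \<longleftrightarrow> linked E (- T) i j)"
proof -
  let ?r = "\<lambda>i. SOME k. k \<in> component_of E (- T) i"
  have r: "linked E (- T) k (?r k)" if "k \<notin> T" for k
    using someI[of "\<lambda>l. l \<in> component_of E (- T) k" k] in_component_of[of k "- T" E] that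
    by (simp add: component_of_def)
  have eq: "?r i = ?r j \<longleftrightarrow> linked E (- T) i j" if ij: "i \<notin> T" "j \<notin> T" for i j
  proof
    assume "?r i = ?r j"
    then show "linked E (- T) i j"
      using r[OF ij(1)] r[OF ij(2)] linked_sym[OF assms] linked_trans by metis
  next
    assume "linked E (- T) i j"
    then have "component_of E (- T) i = component_of E (- T) j"
      using ij component_of_eq_iff[OF assms, of i "- T" j] by simp
    then show "?r i = ?r j"
      by simp
  qed
  show ?thesis
    by (intro exI[of _ ?r] allI impI) (rule eq)
qed

lemma
  fixes E :: "('n::{finite,linorder} \<times> 'n) set"
  assumes "sym E"
  shows prime_cutset_prime: "is_prime_ideal (cutset_prime E T :: ('n, 'k::field) bpoly set)"
    and initial_mons_cutset_prime:
      "initial_mons (cutset_prime E T :: ('n, 'k) bpoly set) = {m. \<not> standard_for E T m}"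
    and homogeneous_component_cutset_prime:
      "f \<in> (cutset_prime E T :: ('n, 'k) bpoly set) \<Longrightarrow> homogeneous_component d f \<in> cutset_prime E T"
proof -
  obtain r :: "'n \<Rightarrow> 'n"
    where r: "\<forall>i j. i \<notin> T \<longrightarrow> j \<notin> T \<longrightarrow> (r i = r j \<longleftrightarrow> linked E (- T) i j)"
    by (rule exE[OF component_labelling[OF assms, of T]])
  note conv = cutset_prime_conv_minors_ideal[OF assms r]
  show "is_prime_ideal (cutset_prime E T :: ('n, 'k::field) bpoly set)"
    unfolding conv by (rule prime_minors_ideal)
  show "f \<in> (cutset_prime E T :: ('n, 'k) bpoly set) \<Longrightarrow> homogeneous_component d f \<in> cutset_prime E T"
    unfolding conv by (rule homogeneous_component_minors_ideal)
  have "standard_mon (\<lambda>i j. r i = r j) T m \<longleftrightarrow> standard_for E T m" for m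
  proof -
    have "i \<notin> T \<and> j \<notin> T" if "mon_support m \<inter> T = {}"
      "Poly_Mapping.lookup m (X i) \<noteq> 0" "Poly_Mapping.lookup m (Y j) \<noteq> 0" for i j
      using that by (auto simp: mon_support_def)
    then show ?thesis
      unfolding standard_mon_def using r by metis
  qed
  then show "initial_mons (cutset_prime E T :: ('n, 'k) bpoly set) = {m. \<not> standard_for E T m}"
    unfolding conv initial_mons_minors_ideal by simp
qed

text \<open>
  If \<open>t \<in> T\<close> does not connect two components, putting it back into the graph creates no new
  connections between the remaining vertices, and \<open>t\<close> itself is not in the support of \<open>m\<close>. So \<open>T\<close>
  can be shrunk until every element is a cut vertex.
\<close>

lemma standard_for_imp_standard_for_cutset:
  fixes E :: "('n::{finite,linorder} \<times> 'n) set"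
  assumes "sym E" "standard_for E T m"
  shows "\<exists>T'\<in>cutsets E. standard_for E T' m"
  using assms(2)
proof (induction "card T" arbitrary: T rule: less_induct)
  case less
  show ?case
  proof (cases "T \<in> cutsets E")
    case True
    with less.prems show ?thesis by blast
  next
    case False
    then obtain t where t: "t \<in> T"
      and no_new: "\<And>a b. a \<notin> T \<Longrightarrow> b \<notin> T \<Longrightarrow> linked E (- (T - {t})) a b \<Longrightarrow> linked E (- T) a b"
      unfolding cutset_iff[OF assms(1)] by blast
    have nz: "i \<notin> T" if "i \<in> mon_support m" for i
      using that less.prems by (auto simp: standard_mon_def)
    have "standard_for E (T - {t}) m"
      unfolding standard_mon_def
    proof (intro conjI allI impI)
      show "mon_support m \<inter> (T - {t}) = {}"
        using nz by blast
      fix i j assume ij: "i < j \<and> linked E (- (T - {t})) i j"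
      show "Poly_Mapping.lookup m (X i) = 0 \<or> Poly_Mapping.lookup m (Y j) = 0"
      proof (rule ccontr)
        assume xy: "\<not> ?thesis"
        then have "i \<notin> T" "j \<notin> T"
          using nz[of i] nz[of j] by (auto simp: mon_support_def)
        then have "linked E (- T) i j"
          using ij by (auto intro: no_new)
        with ij xy less.prems[unfolded standard_mon_def] show False
          by metis
      qed
    qed
    moreover have "card (T - {t}) < card T"
      using t by (intro card_Diff1_less) auto
    ultimately show ?thesis
      using less.hyps by blast
  qed
qed

lemma edge_binomial_commute: "edge_binomial j i = - edge_binomial i j"
  by (simp add: edge_binomial_def)

lemma edge_binomial_in_binomial_edge_ideal:
  assumes "sym E" "(i, j) \<in> E"
  shows "edge_binomial i j \<in> binomial_edge_ideal E"
proof -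
  have gen: "edge_binomial a b \<in> binomial_edge_ideal E" if "(a, b) \<in> E" "a < b" for a b
    using that unfolding binomial_edge_ideal_def by (intro ideal_gen_base) blast
  have idl: "is_ideal (binomial_edge_ideal E)"
    unfolding binomial_edge_ideal_def by (rule is_ideal_ideal_gen)
  consider "i < j" | "j < i" | "i = j"
    by fastforce
  then show ?thesis
  proof cases
    case 1 then show ?thesis using gen assms by blast
  next
    case 2
    then show ?thesis
      using gen[of j i] assms ideal_uminus[OF idl, of "edge_binomial j i"]
      by (simp add: edge_binomial_commute[of i j] symD)
  next
    case 3 then show ?thesis using ideal_zero[OF idl] by (simp add: edge_binomial_def)
  qed
qed

text \<open>
  Starting at the last visit to \<open>i\<close>, a walk never returns there. This allows induction along a
  path by removing its initial vertex, without introducing simple paths.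
\<close>

lemma rtrancl_leave_start:
  assumes "(i, j) \<in> R\<^sup>*" "i \<noteq> j"
  shows "\<exists>w. (i, w) \<in> R \<and> w \<noteq> i \<and> (w, j) \<in> (R \<inter> (- {i}) \<times> (- {i}))\<^sup>*"
proof -
  have "j = i \<or> (\<exists>w. (i, w) \<in> R \<and> w \<noteq> i \<and> (w, j) \<in> (R \<inter> (- {i}) \<times> (- {i}))\<^sup>*)"
    using assms(1)
  proof (induction rule: rtrancl_induct)
    case base
    show ?case by simp
  next
    case (step j k)
    show ?case
    proof (cases "k = i \<or> j = i")
      case True
      then show ?thesis using step.hyps by auto
    next
      case False
      then obtain w where w: "(i, w) \<in> R" "w \<noteq> i" "(w, j) \<in> (R \<inter> (- {i}) \<times> (- {i}))\<^sup>*"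
        using step.IH by blast
      moreover have "(j, k) \<in> R \<inter> (- {i}) \<times> (- {i})"
        using False step.hyps by simp
      ultimately show ?thesis
        by (meson rtrancl.rtrancl_into_rtrancl)
    qed
  qed
  with assms(2) show ?thesis by simp
qed

text \<open>
  Induction along a path from \<open>i\<close> to \<open>j\<close> with first step \<open>w\<close>, by the identities
  \<open>x\<^sub>w f\<^sub>i\<^sub>j = x\<^sub>i f\<^sub>w\<^sub>j + x\<^sub>j f\<^sub>i\<^sub>w\<close> and \<open>y\<^sub>w f\<^sub>i\<^sub>j = y\<^sub>i f\<^sub>w\<^sub>j + y\<^sub>j f\<^sub>i\<^sub>w\<close>: each inner vertex uses up one of its
  two variables.
\<close>

lemma monomial_times_edge_binomial_mem:
  fixes E :: "('n::{finite,linorder} \<times> 'n) set"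
  assumes "sym E" "linked E W i j" "i \<noteq> j" "W - {i, j} \<subseteq> mon_support m"
  shows "Poly_Mapping.single m 1 * edge_binomial i j \<in> (binomial_edge_ideal E :: ('n, 'k::field) bpoly set)"
  using assms(2-)
proof (induction "card W" arbitrary: W i m rule: less_induct)
  case less
  let ?J = "binomial_edge_ideal E :: ('n, 'k::field) bpoly set"
  have idl: "is_ideal ?J"
    unfolding binomial_edge_ideal_def by (rule is_ideal_ideal_gen)
  have "(i, j) \<in> (E \<inter> W \<times> W)\<^sup>*"
    using less.prems by (simp add: linked_def)
  then obtain w where w: "(i, w) \<in> E" "w \<in> W" "i \<in> W" "w \<noteq> i"
    and rest: "(w, j) \<in> (E \<inter> W \<times> W \<inter> (- {i}) \<times> (- {i}))\<^sup>*"
    using rtrancl_leave_start[of i j "E \<inter> W \<times> W"] less.prems(2) by blast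
  have iw: "edge_binomial i w \<in> ?J"
    using assms(1) w(1) by (rule edge_binomial_in_binomial_edge_ideal)
  show ?case
  proof (cases "w = j")
    case True
    with iw show ?thesis
      by (simp add: ideal_mult[OF idl])
  next
    case False
    then have "w \<in> mon_support m"
      using w less.prems(3) by blast
    then obtain u where u: "u = X w \<or> u = Y w" "Poly_Mapping.lookup m u \<noteq> 0"
      by (auto simp: mon_support_def)
    define n where "n = m - Poly_Mapping.single u 1"
    have m: "m = n + Poly_Mapping.single u 1"
      using u(2) by (intro poly_mapping_eqI) (auto simp: n_def lookup_add lookup_minus lookup_single when_def)
    have "E \<inter> W \<times> W \<inter> (- {i}) \<times> (- {i}) = E \<inter> (W - {i}) \<times> (W - {i})"
      by blast
    with rest have "linked E (W - {i}) w j"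
      using w less.prems by (simp add: linked_def)
    moreover have "card (W - {i}) < card W"
      using w(3) by (intro card_Diff1_less) auto
    moreover have "W - {i} - {w, j} \<subseteq> mon_support n"
    proof
      fix k assume k: "k \<in> W - {i} - {w, j}"
      then have "k \<in> mon_support m"
        using less.prems(3) by blast
      then show "k \<in> mon_support n"
        using k u(1) by (auto simp: m mon_support_def lookup_add lookup_single when_def)
    qed
    ultimately have wj: "Poly_Mapping.single n 1 * edge_binomial w j \<in> ?J"
      using less.hyps False by blast
    let ?n = "Poly_Mapping.single n 1 :: ('n, 'k) bpoly"
    have sm: "(Poly_Mapping.single m 1 :: ('n, 'k) bpoly) = ?n * indet u"
      by (simp add: m indet_def mult_single)
    from u(1) show ?thesis
    proof
      assume "u = X w"
      then have "Poly_Mapping.single m 1 * edge_binomial i j =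
          indet (X i) * (?n * edge_binomial w j) + ?n * indet (X j) * edge_binomial i w"
        unfolding sm edge_binomial_def by (simp add: algebra_simps)
      then show ?thesis
        using wj iw by (simp add: ideal_add[OF idl] ideal_mult[OF idl])
    next
      assume "u = Y w"
      then have "Poly_Mapping.single m 1 * edge_binomial i j =
          indet (Y i) * (?n * edge_binomial w j) + ?n * indet (Y j) * edge_binomial i w"
        unfolding sm edge_binomial_def by (simp add: algebra_simps)
      then show ?thesis
        using wj iw by (simp add: ideal_add[OF idl] ideal_mult[OF idl])
    qed
  qed
qed

text \<open>
  With the complement of the support as the removed set, connections run through the support of
  \<open>m\<close> only. Dividing \<open>m\<close> by the offending \<open>x\<^sub>i y\<^sub>j\<close> leaves a monomial that still involves every
  inner vertex of a path from \<open>i\<close> to \<open>j\<close>.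
\<close>

lemma initial_mons_binomial_edge_ideal_if_nonstandard:
  fixes E :: "('n::{finite,linorder} \<times> 'n) set"
  assumes "sym E" "\<not> standard_for E (- mon_support m) m"
  shows "m \<in> initial_mons (binomial_edge_ideal E :: ('n, 'k::field) bpoly set)"
proof -
  let ?J = "binomial_edge_ideal E :: ('n, 'k) bpoly set"
  obtain i j where ij: "i < j" "linked E (mon_support m) i j"
    "Poly_Mapping.lookup m (X i) \<noteq> 0" "Poly_Mapping.lookup m (Y j) \<noteq> 0"
    using assms(2) by (auto simp: standard_mon_def)
  define n where "n = m - xy_mon i j"
  have m: "m = n + xy_mon i j"
    using ij by (intro poly_mapping_eqI) (auto simp: n_def lookup_add lookup_minus lookup_single when_def)
  have "mon_support m - {i, j} \<subseteq> mon_support n"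
    by (auto simp: m mon_support_def lookup_add lookup_single when_def split: if_splits)
  then have mem: "Poly_Mapping.single n 1 * edge_binomial i j \<in> ?J"
    using ij by (intro monomial_times_edge_binomial_mem[OF assms(1)]) auto
  have nz: "(Poly_Mapping.single n 1 :: ('n, 'k) bpoly) \<noteq> 0"
    by (metis lookup_single_eq lookup_zero zero_neq_one)
  have "initial_mon (Poly_Mapping.single n 1 * edge_binomial i j :: ('n, 'k) bpoly) = m"
    by (subst initial_mon_mult[OF nz initial_mon_edge_binomial(1)[OF ij(1)]])
       (simp only: initial_mon_edge_binomial(2)[OF ij(1)] m, simp add: initial_mon_def)
  moreover have "Poly_Mapping.single n 1 * edge_binomial i j \<noteq> (0 :: ('n, 'k) bpoly)"
    using nz initial_mon_edge_binomial(1)[OF ij(1)] by simp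
  ultimately show ?thesis
    using mem by (force simp: initial_mons_def)
qed

lemma binomial_edge_ideal_subset_cutset_prime:
  assumes "sym E"
  shows "binomial_edge_ideal E \<subseteq> cutset_prime E T"
  unfolding binomial_edge_ideal_def
proof (rule ideal_gen_least)
  show idl: "is_ideal (cutset_prime E T)"
    unfolding cutset_prime_def by (rule is_ideal_ideal_gen)
  have "edge_binomial i j \<in> cutset_prime E T" if "(i, j) \<in> E" "i < j" for i j
  proof (cases "i \<in> T \<or> j \<in> T")
    case True
    have "indet (X k) \<in> cutset_prime E T" "indet (Y k) \<in> cutset_prime E T" if "k \<in> T" for k
      using that unfolding cutset_prime_def by (auto intro!: ideal_gen_base)
    with True show ?thesis
      unfolding edge_binomial_def
      by (metis ideal_diff[OF idl] ideal_mult[OF idl] ideal_mult_right[OF idl])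
  next
    case False
    then have "linked E (- T) i j"
      using that by (intro linked_edge) auto
    then show ?thesis
      unfolding cutset_prime_def same_component_iff[OF assms] using that
      by (intro ideal_gen_base) blast
  qed
  then show "{edge_binomial i j | i j. (i, j) \<in> E \<and> i < j} \<subseteq> cutset_prime E T"
    by blast
qed

text \<open>
  The initial monomials of \<open>J\<close> lie among those of the intersection, these lie among the monomials
  that are nonstandard for every cutset, and the latter are initial monomials of \<open>J\<close>. So all three
  sets agree. This also shows that the initial monomials of \<open>J\<close> do not depend on the field.
\<close>

lemma
  fixes E :: "('n::{finite,linorder} \<times> 'n) set"
  assumes "sym E"
  shows binomial_edge_ideal_conv_Inter:
      "(binomial_edge_ideal E :: ('n, 'k::field) bpoly set) = (\<Inter>T\<in>cutsets E. cutset_prime E T)"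
    and initial_mons_binomial_edge_ideal:
      "initial_mons (binomial_edge_ideal E :: ('n, 'k) bpoly set) =
         {m. \<forall>T\<in>cutsets E. \<not> standard_for E T m}"
proof -
  let ?J = "binomial_edge_ideal E :: ('n, 'k) bpoly set"
  let ?K = "(\<Inter>T\<in>cutsets E. cutset_prime E T) :: ('n, 'k) bpoly set"
  let ?N = "{m. \<forall>T\<in>cutsets E. \<not> standard_for E T m}"
  have sub: "?J \<subseteq> ?K"
    using binomial_edge_ideal_subset_cutset_prime[OF assms] by blast
  have K: "initial_mons ?K \<subseteq> ?N"
  proof
    fix m assume m: "m \<in> initial_mons ?K"
    have "m \<in> initial_mons (cutset_prime E T :: ('n, 'k) bpoly set)" if "T \<in> cutsets E" for T
    proof -
      have "?K \<subseteq> cutset_prime E T"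
        using that by blast
      then show ?thesis
        using initial_mons_mono m by blast
    qed
    then show "m \<in> ?N"
      by (simp add: initial_mons_cutset_prime[OF assms])
  qed
  have N: "?N \<subseteq> initial_mons ?J"
    using initial_mons_binomial_edge_ideal_if_nonstandard[OF assms]
      standard_for_imp_standard_for_cutset[OF assms] by blast
  have "is_ideal ?J"
    unfolding binomial_edge_ideal_def by (rule is_ideal_ideal_gen)
  moreover have "is_ideal ?K"
    by (intro ideal_Inter prime_imp_ideal prime_cutset_prime[OF assms])
  ultimately show eq: "?J = ?K"
    using sub K N by (intro ideal_eq_if_initial_mons_subset) auto
  show "initial_mons ?J = ?N"
    using K N unfolding eq by auto
qed


section \<open>The monomial primes of the initial ideal\<close>

definition prime_vars :: "('n::linorder \<times> 'n) set \<Rightarrow> 'n set \<Rightarrow> ('n set \<Rightarrow> 'n) \<Rightarrow> 'n var set" where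
  "prime_vars E T v = X ` T \<union> Y ` T \<union>
     (\<Union>C\<in>components_on E (- T). {X i | i. i \<in> C \<and> i < v C} \<union> {Y j | j. j \<in> C \<and> v C < j})"

lemma monomial_prime_conv_vars: "monomial_prime E T v = ideal_gen (indet ` prime_vars E T v)"
  unfolding monomial_prime_def prime_vars_def setcompr_eq_image image_Un image_UN image_image
    Collect_mem_eq ..

lemma prime_vars_iff:
  assumes "sym E"
  shows "X i \<in> prime_vars E T v \<longleftrightarrow> i \<in> T \<or> i < v (component_of E (- T) i)"
    and "Y i \<in> prime_vars E T v \<longleftrightarrow> i \<in> T \<or> v (component_of E (- T) i) < i"
proof -
  have comp: "C \<in> components_on E (- T) \<and> i \<in> C \<longleftrightarrow> i \<notin> T \<and> C = component_of E (- T) i" for C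
    using component_unique[OF assms, of C "- T" i] in_component_of[of i "- T" E]
    by (auto simp: components_on_conv)
  have "X i \<in> prime_vars E T v \<longleftrightarrow>
      i \<in> T \<or> (\<exists>C. (C \<in> components_on E (- T) \<and> i \<in> C) \<and> i < v C)"
    by (auto simp: prime_vars_def)
  then show "X i \<in> prime_vars E T v \<longleftrightarrow> i \<in> T \<or> i < v (component_of E (- T) i)"
    unfolding comp by blast
  have "Y i \<in> prime_vars E T v \<longleftrightarrow>
      i \<in> T \<or> (\<exists>C. (C \<in> components_on E (- T) \<and> i \<in> C) \<and> v C < i)"
    by (auto simp: prime_vars_def)
  then show "Y i \<in> prime_vars E T v \<longleftrightarrow> i \<in> T \<or> v (component_of E (- T) i) < i"
    unfolding comp by blast
qed

lemma mem_monomial_prime_iff: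
  "f \<in> (monomial_prime E T v :: ('n::linorder, 'k::field) bpoly set) \<longleftrightarrow>
    (\<forall>m\<in>Poly_Mapping.keys f. \<exists>u\<in>prime_vars E T v. Poly_Mapping.lookup m u \<noteq> 0)"
proof -
  have "(\<exists>a. m = a + Poly_Mapping.single u 1) \<longleftrightarrow> Poly_Mapping.lookup m u \<noteq> 0" for m :: "'n mon" and u
  proof
    assume "Poly_Mapping.lookup m u \<noteq> 0"
    then have "m = (m - Poly_Mapping.single u 1) + Poly_Mapping.single u 1"
      by (intro poly_mapping_eqI) (auto simp: lookup_add lookup_minus lookup_single when_def)
    then show "\<exists>a. m = a + Poly_Mapping.single u 1" ..
  qed (auto simp: lookup_add)
  moreover have "indet ` prime_vars E T v =
      (\<lambda>m. Poly_Mapping.single m 1 :: ('n, 'k) bpoly) ` (\<lambda>u. Poly_Mapping.single u 1) ` prime_vars E T v"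
    by (simp add: image_image indet_def)
  ultimately show ?thesis
    unfolding monomial_prime_conv_vars by (simp only: mem_monomial_ideal_iff bex_simps)
qed

lemma prime_monomial_prime:
  "is_prime_ideal (monomial_prime E T v :: ('n::linorder, 'k::field) bpoly set)"
proof -
  let ?A = "{m :: 'n mon. \<forall>u\<in>prime_vars E T v. Poly_Mapping.lookup m u = 0}"
  have "push_forward ?A (\<lambda>m. m) f = 0 \<longleftrightarrow> f \<in> monomial_prime E T v" for f :: "('n, 'k) bpoly"
  proof -
    have "push_forward ?A (\<lambda>m. m) f = 0 \<longleftrightarrow> Poly_Mapping.keys f \<inter> ?A = {}"
      by (simp only: keys_eq_empty[symmetric] keys_restrict)
    also have "\<dots> \<longleftrightarrow> f \<in> monomial_prime E T v"
      unfolding mem_monomial_prime_iff disjoint_iff by auto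
    finally show ?thesis .
  qed
  moreover have "is_face ?A"
    by (auto simp: is_face_def lookup_add)
  ultimately show ?thesis
    using prime_kernel_push_forward[of ?A "\<lambda>m. m", where 'k = 'k] by simp
qed

lemma standard_for_if_avoids_prime_vars:
  fixes E :: "('n::linorder \<times> 'n) set"
  assumes "sym E" and avoid: "\<And>u. u \<in> prime_vars E T v \<Longrightarrow> Poly_Mapping.lookup m u = 0"
  shows "standard_for E T m"
  unfolding standard_mon_def
proof (intro conjI allI impI)
  show "mon_support m \<inter> T = {}"
    using avoid by (auto simp: mon_support_def prime_vars_iff[OF assms(1)])
  fix i j assume ij: "i < j \<and> linked E (- T) i j"
  then have "component_of E (- T) i = component_of E (- T) j"
    using component_of_eq_iff[OF assms(1), of i "- T" j] by (auto simp: linked_def)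
  moreover have "i < v (component_of E (- T) i) \<or> v (component_of E (- T) i) < j"
    using ij by auto
  ultimately show "Poly_Mapping.lookup m (X i) = 0 \<or> Poly_Mapping.lookup m (Y j) = 0"
    using avoid[of "X i"] avoid[of "Y j"] prime_vars_iff[OF assms(1), of _ T v] by auto
qed

text \<open>
  In a component where \<open>m\<close> contains some \<open>x\<^sub>i\<close>, the least such \<open>i\<close> can serve as \<open>v\<close>: a \<open>y\<^sub>j\<close> in \<open>m\<close>
  with \<open>j > i\<close> would give a forbidden pair. In a component without any \<open>x\<^sub>i\<close> the maximal vertex
  works. Together with the converse above, this says that \<open>in P\<^sub>T\<close> is the intersection of the
  \<open>P\<^sub>T(v)\<close>.
\<close>

lemma standard_for_imp_avoids_prime_vars:
  fixes E :: "('n::{finite,linorder} \<times> 'n) set"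
  assumes "sym E" "standard_for E T m"
  shows "\<exists>v\<in>(\<Pi> C\<in>components_on E (- T). C). \<forall>u\<in>prime_vars E T v. Poly_Mapping.lookup m u = 0"
proof -
  let ?x = "\<lambda>C. {i \<in> C. Poly_Mapping.lookup m (X i) \<noteq> 0}"
  define v where "v C = (if ?x C \<noteq> {} then Min (?x C) else Max C)" for C
  have v: "v \<in> (\<Pi> C\<in>components_on E (- T). C)"
  proof
    fix C assume "C \<in> components_on E (- T)"
    then obtain i where "i \<in> - T" "C = component_of E (- T) i"
      unfolding components_on_conv by (elim imageE)
    then have "C \<noteq> {}"
      using in_component_of[of i "- T" E] by blast
    moreover have "Min (?x C) \<in> ?x C" if "?x C \<noteq> {}"
      using that by (intro Min_in) auto
    ultimately show "v C \<in> C"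
      by (auto simp: v_def)
  qed
  have T: "Poly_Mapping.lookup m (X i) = 0 \<and> Poly_Mapping.lookup m (Y i) = 0" if "i \<in> T" for i
    using assms(2) that by (auto simp: standard_mon_def mon_support_def)
  have "Poly_Mapping.lookup m u = 0" if u: "u \<in> prime_vars E T v" for u
  proof (rule ccontr)
    assume nz: "Poly_Mapping.lookup m u \<noteq> 0"
    show False
    proof (cases u)
      case (X i)
      let ?C = "component_of E (- T) i"
      have i: "i \<notin> T" "i < v ?C"
        using u nz T[of i] unfolding X prime_vars_iff[OF assms(1)] by auto
      then have "i \<in> ?x ?C"
        using nz in_component_of[of i "- T" E] by (simp add: X)
      then have "v ?C \<le> i"
        by (auto simp: v_def intro: Min_le)
      with i show False by simp
    next
      case (Y j)
      let ?C = "component_of E (- T) j"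
      have j: "j \<notin> T" "v ?C < j"
        using u nz T[of j] unfolding Y prime_vars_iff[OF assms(1)] by auto
      then have jC: "j \<in> ?C"
        using in_component_of[of j "- T" E] by simp
      show False
      proof (cases "?x ?C = {}")
        case True
        then have "v ?C = Max ?C" by (simp add: v_def)
        moreover have "j \<le> Max ?C" using jC by (intro Max_ge) auto
        ultimately show False using j(2) by simp
      next
        case False
        then have "v ?C = Min (?x ?C)" by (simp add: v_def)
        moreover have "Min (?x ?C) \<in> ?x ?C" using False by (intro Min_in) auto
        ultimately obtain i where i: "i \<in> ?x ?C" "i < j"
          using j(2) by metis
        then have "linked E (- T) i j"
          by (auto simp: component_of_def intro: linked_sym[OF assms(1)])
        moreover have "Poly_Mapping.lookup m (X i) \<noteq> 0" "Poly_Mapping.lookup m (Y j) \<noteq> 0"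
          using i nz Y by auto
        ultimately show False
          using assms(2) i(2) unfolding standard_mon_def by metis
      qed
    qed
  qed
  then show ?thesis
    by (intro bexI[OF _ v] ballI)
qed

text \<open>
  The vertices with both variables in \<open>P\<^sub>T(v)\<close> are those of \<open>T\<close>, and those with neither are the chosen
  ones, exactly one in each component. An inclusion therefore gives \<open>T' \<subseteq> T\<close>. If \<open>t \<in> T\<close> were not
  in \<open>T'\<close>, it would connect two components for \<open>T\<close>, as \<open>T\<close> is a cutset. Their chosen vertices
  then lie in one component for \<open>T'\<close> and neither of their variables is in the smaller prime, so
  both are its chosen vertex: a contradiction.
\<close>

lemma cutset_prime_vars_incomparable:
  fixes E :: "('n::{finite,linorder} \<times> 'n) set"
  assumes "sym E" "T \<in> cutsets E" "v \<in> (\<Pi> C\<in>components_on E (- T). C)"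
    and sub: "prime_vars E T' v' \<subseteq> prime_vars E T v"
  shows "T' = T"
proof (rule ccontr)
  assume "T' \<noteq> T"
  note iff = prime_vars_iff[OF assms(1)]
  have "T' \<subseteq> T"
  proof
    fix i assume "i \<in> T'"
    then have "X i \<in> prime_vars E T v" "Y i \<in> prime_vars E T v"
      using sub iff[of i T' v'] by auto
    then show "i \<in> T"
      unfolding iff by auto
  qed
  with \<open>T' \<noteq> T\<close> obtain t where t: "t \<in> T" "t \<notin> T'"
    by blast
  then obtain a b where ab: "a \<notin> T" "b \<notin> T" "linked E (- (T - {t})) a b" "\<not> linked E (- T) a b"
    using assms(2) unfolding cutset_iff[OF assms(1)] by blast
  have anchor: "linked E (- T) i (v (component_of E (- T) i))" if "i \<notin> T" for i
    using assms(3) that by (auto simp: components_on_conv component_of_def Pi_iff)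
  have free: "p = v' (component_of E (- T') p)" "linked E (- T) i p"
    if "i \<notin> T" "p = v (component_of E (- T) i)" for i p
  proof -
    show ip: "linked E (- T) i p"
      using anchor that by simp
    then have "component_of E (- T) p = component_of E (- T) i"
      using component_of_eq_iff[OF assms(1), of i "- T" p] by (simp add: linked_def)
    moreover have "p \<notin> T"
      using ip by (simp add: linked_def)
    ultimately have "X p \<notin> prime_vars E T v" "Y p \<notin> prime_vars E T v"
      using that(2) unfolding iff by auto
    then have "X p \<notin> prime_vars E T' v'" "Y p \<notin> prime_vars E T' v'"
      using sub by auto
    then show "p = v' (component_of E (- T') p)"
      unfolding iff by auto
  qed
  define p q where "p = v (component_of E (- T) a)" and "q = v (component_of E (- T) b)"
  note p = free[OF ab(1) p_def] and q = free[OF ab(2) q_def]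
  have up: "linked E (- T') i j" if "linked E (- T) i j" for i j
    using that \<open>T' \<subseteq> T\<close> by (auto intro: linked_mono)
  have "linked E (- T') a b"
    by (rule linked_mono[OF ab(3)]) (use \<open>T' \<subseteq> T\<close> t in auto)
  then have "linked E (- T') p q"
    using up[OF p(2)] up[OF q(2)] linked_sym[OF assms(1)] linked_trans by metis
  then have "component_of E (- T') p = component_of E (- T') q"
    using component_of_eq_iff[OF assms(1), of p "- T'" q] by (simp add: linked_def)
  then have "p = q"
    using p(1) q(1) by simp
  then have "linked E (- T) a b"
    using p(2) q(2) linked_sym[OF assms(1)] linked_trans by metis
  with ab(4) show False ..
qed


section \<open>Comparison of the v-numbers\<close>

text \<open>
  As much of the radicality of \<open>in J\<close> as is needed: \<open>in J\<close> is an intersection of monomial primes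
  \<open>P\<^sub>T(v)\<close>.
\<close>

lemma initial_ideal_binomial_edge_ideal_square:
  fixes E :: "('n::{finite,linorder} \<times> 'n) set" and f :: "('n, 'k::field) bpoly"
  assumes "sym E" "f * f \<in> initial_ideal (binomial_edge_ideal E)"
  shows "f \<in> initial_ideal (binomial_edge_ideal E)"
proof (rule ccontr)
  let ?J = "binomial_edge_ideal E :: ('n, 'k) bpoly set"
  have idl: "is_ideal ?J"
    unfolding binomial_edge_ideal_def by (rule is_ideal_ideal_gen)
  note mem = mem_initial_ideal_iff[OF idl] initial_mons_binomial_edge_ideal[OF assms(1)]
  assume "f \<notin> initial_ideal ?J"
  then obtain m T where m: "m \<in> Poly_Mapping.keys f" "T \<in> cutsets E" "standard_for E T m"
    unfolding mem by blast
  from standard_for_imp_avoids_prime_vars[OF assms(1) m(3)] obtain v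
    where v: "\<And>u. u \<in> prime_vars E T v \<Longrightarrow> Poly_Mapping.lookup m u = 0"
    by blast
  have "f * f \<in> (monomial_prime E T v :: ('n, 'k) bpoly set)"
    using assms(2) standard_for_if_avoids_prime_vars[OF assms(1)] m(2)
    unfolding mem mem_monomial_prime_iff by blast
  then have "f \<in> (monomial_prime E T v :: ('n, 'k) bpoly set)"
    using prime_monomial_prime unfolding is_prime_ideal_def by blast
  then obtain u where "u \<in> prime_vars E T v" "Poly_Mapping.lookup m u \<noteq> 0"
    using m(1) by (auto simp: mem_monomial_prime_iff)
  then show False
    using v by simp
qed

text \<open>
  If \<open>m\<close> avoids the variables of \<open>P\<^sub>T(v)\<close> but \<open>u m\<close> does not, then \<open>u\<close> is one of them; so
  \<open>P\<^sub>T(v)\<close> would contain \<open>P\<^sub>T\<^sub>'(v')\<close>.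
\<close>

lemma nonstandard_if_monomial_prime_kills:
  fixes E :: "('n::{finite,linorder} \<times> 'n) set"
  assumes "sym E" "T \<in> cutsets E" "T \<noteq> T'"
    and kill: "\<And>u. u \<in> prime_vars E T' v' \<Longrightarrow> \<not> standard_for E T (Poly_Mapping.single u 1 + m)"
  shows "\<not> standard_for E T m"
proof
  assume "standard_for E T m"
  from standard_for_imp_avoids_prime_vars[OF assms(1) this] obtain v
    where v: "v \<in> (\<Pi> C\<in>components_on E (- T). C)"
      "\<forall>u\<in>prime_vars E T v. Poly_Mapping.lookup m u = 0"
    by (elim bexE)
  have "prime_vars E T' v' \<subseteq> prime_vars E T v"
  proof
    fix u assume "u \<in> prime_vars E T' v'"
    then obtain w where w: "w \<in> prime_vars E T v" "Poly_Mapping.lookup (Poly_Mapping.single u 1 + m) w \<noteq> 0"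
      using kill standard_for_if_avoids_prime_vars[OF assms(1)] by metis
    then have "u = w"
      using bspec[OF v(2) w(1)] by (auto simp: lookup_add lookup_single when_def split: if_splits)
    with w(1) show "u \<in> prime_vars E T v"
      by simp
  qed
  then have "T' = T"
    by (rule cutset_prime_vars_incomparable[OF assms(1,2) v(1)])
  with assms(3) show False
    by simp
qed

text \<open>
  The product of elements with initial monomial \<open>m\<close>, one from each ideal, lies in the
  intersection. For an empty index set the product and the power are both \<open>1\<close>.
\<close>

lemma initial_monomial_power_mem:
  fixes P :: "'i \<Rightarrow> ('n::linorder, 'k::field) bpoly set"
  assumes "finite A" "\<And>i. i \<in> A \<Longrightarrow> is_ideal (P i)" "\<And>i. i \<in> A \<Longrightarrow> m \<in> initial_mons (P i)"
  shows "Poly_Mapping.single m 1 ^ card A \<in> initial_ideal (\<Inter>i\<in>A. P i)"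
proof -
  have "\<exists>g. g \<in> P i \<and> g \<noteq> 0 \<and> initial_mon g = m" if "i \<in> A" for i
    using assms(3)[OF that] by (auto simp: initial_mons_def)
  then obtain g where g: "\<And>i. i \<in> A \<Longrightarrow> g i \<in> P i \<and> g i \<noteq> 0 \<and> initial_mon (g i) = m"
    by metis
  have "Poly_Mapping.single (initial_mon (prod g B)) (1 :: 'k) = Poly_Mapping.single m 1 ^ card B \<and> prod g B \<noteq> 0"
    if "finite B" "B \<subseteq> A" for B
    using that
  proof (induction B rule: finite_induct)
    case empty
    have "initial_mon (1 :: ('n, 'k) bpoly) = 0"
      by (simp add: initial_mon_def)
    then show ?case by simp
  next
    case (insert i B)
    have nz: "g i \<noteq> 0" "prod g B \<noteq> 0" and gi: "initial_mon (g i) = m"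
      using insert g by auto
    have "initial_mon (g i * prod g B) = m + initial_mon (prod g B)"
      using initial_mon_mult[OF nz] gi by simp
    then have "Poly_Mapping.single (initial_mon (g i * prod g B)) (1 :: 'k) =
        Poly_Mapping.single m 1 * Poly_Mapping.single (initial_mon (prod g B)) 1"
      by (simp add: mult_single)
    then show ?case
      using insert nz by simp
  qed
  from this[of A] assms(1)
  have "Poly_Mapping.single (initial_mon (prod g A)) (1 :: 'k) = Poly_Mapping.single m 1 ^ card A"
    "prod g A \<noteq> 0"
    by auto
  moreover have "prod g A \<in> (\<Inter>i\<in>A. P i)"
  proof
    fix i assume i: "i \<in> A"
    then have "prod g A = g i * prod g (A - {i})"
      using assms(1) by (simp add: prod.remove)
    then show "prod g A \<in> P i"
      using g[OF i] assms(2)[OF i] by (simp add: ideal_mult_right)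
  qed
  ultimately show ?thesis
    unfolding initial_ideal_def by (intro ideal_gen_base) (metis (mono_tags, lifting) mem_Collect_eq)
qed

text \<open>
  The passage from \<open>f\<close> to a single monomial. The conditions on \<open>m\<close> are purely combinatorial, so they
  can be used over a coefficient field other than that of \<open>f\<close>.
\<close>

lemma monomial_witness_of_colon:
  fixes E :: "('n::{finite,linorder} \<times> 'n) set" and f :: "('n, 'k::field) bpoly"
  assumes "sym E" and f: "f \<in> homogeneous_part d"
    and colon: "colon (initial_ideal (binomial_edge_ideal E)) f = monomial_prime E T' v'"
  shows "\<exists>m. mon_degree m = d \<and> (\<forall>u\<in>prime_vars E T' v'. Poly_Mapping.lookup m u = 0) \<and>
    (\<forall>u\<in>prime_vars E T' v'. \<forall>T\<in>cutsets E. \<not> standard_for E T (Poly_Mapping.single u 1 + m))"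
proof -
  let ?J = "binomial_edge_ideal E :: ('n, 'k) bpoly set"
  let ?P = "monomial_prime E T' v' :: ('n, 'k) bpoly set"
  have idl: "is_ideal ?J"
    unfolding binomial_edge_ideal_def by (rule is_ideal_ideal_gen)
  \<comment> \<open>Otherwise \<open>f\<^sup>2\<close>, and hence \<open>f\<close>, is in the initial ideal, and the colon ideal is everything.\<close>
  have "f \<notin> ?P"
  proof
    assume "f \<in> ?P"
    then have "f * f \<in> initial_ideal ?J"
      using colon by (auto simp: colon_def)
    then have "f \<in> initial_ideal ?J"
      by (rule initial_ideal_binomial_edge_ideal_square[OF assms(1)])
    then have "1 \<in> ?P"
      unfolding colon[symmetric] by (simp add: colon_def)
    then have "c * 1 \<in> ?P" for c
      by (rule ideal_mult[OF prime_imp_ideal[OF prime_monomial_prime]])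
    then have "?P = UNIV"
      by auto
    then show False
      using prime_monomial_prime[of E T' v'] unfolding is_prime_ideal_def by metis
  qed
  then obtain m where m: "m \<in> Poly_Mapping.keys f"
    and avoid: "\<forall>u\<in>prime_vars E T' v'. Poly_Mapping.lookup m u = 0"
    unfolding mem_monomial_prime_iff by blast
  have "Poly_Mapping.single u 1 + m \<in> initial_mons ?J" if "u \<in> prime_vars E T' v'" for u
  proof -
    have "indet u \<in> ?P"
      using that by (auto simp: mem_monomial_prime_iff lookup_single when_def)
    then have "indet u * f \<in> initial_ideal ?J"
      using colon by (auto simp: colon_def)
    then have "Poly_Mapping.keys (indet u * f) \<subseteq> initial_mons ?J"
      by (simp only: mem_initial_ideal_iff[OF idl])
    then show ?thesis
      using m unfolding indet_def keys_single_mult by blast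
  qed
  then have "\<forall>u\<in>prime_vars E T' v'. \<forall>T\<in>cutsets E. \<not> standard_for E T (Poly_Mapping.single u 1 + m)"
    unfolding initial_mons_binomial_edge_ideal[OF assms(1)] by blast
  moreover have "mon_degree m = d"
    using f m by (simp add: homogeneous_part_def)
  ultimately show ?thesis
    using avoid by blast
qed

text \<open>
  A monomial witness is the initial monomial of some \<open>q\<close> in \<open>Q\<close>, and the component of \<open>q\<close> in the
  degree of \<open>m\<close> is an element \<open>g\<close> of \<open>Q\<close> with \<open>(J : g) = P\<^sub>T\<^sub>'\<close>.
\<close>

lemma v_number_le_degree_of_monomial_witness:
  fixes E :: "('n::{finite,linorder} \<times> 'n) set"
  assumes "sym E" "T' \<in> cutsets E"
    and rad: "is_radical_ideal
      (initial_ideal (\<Inter>T\<in>cutsets E - {T'}. cutset_prime E T :: ('n, 'k::field) bpoly set))"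
    and avoid: "\<And>u. u \<in> prime_vars E T' v' \<Longrightarrow> Poly_Mapping.lookup m u = 0"
    and kill: "\<And>u T. u \<in> prime_vars E T' v' \<Longrightarrow> T \<in> cutsets E \<Longrightarrow>
      \<not> standard_for E T (Poly_Mapping.single u 1 + m)"
  shows "v_number (binomial_edge_ideal E :: ('n, 'k) bpoly set) \<le> enat (mon_degree m)"
proof -
  let ?J = "binomial_edge_ideal E :: ('n, 'k) bpoly set"
  let ?p = "cutset_prime E T' :: ('n, 'k) bpoly set"
  let ?Q = "(\<Inter>T\<in>cutsets E - {T'}. cutset_prime E T) :: ('n, 'k) bpoly set"
  let ?d = "mon_degree m"
  have idlQ: "is_ideal ?Q"
    by (intro ideal_Inter prime_imp_ideal prime_cutset_prime[OF assms(1)])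
  have JQ: "?J = ?Q \<inter> ?p"
    unfolding binomial_edge_ideal_conv_Inter[OF assms(1)] using assms(2) by blast
  have "m \<in> initial_mons (cutset_prime E T :: ('n, 'k) bpoly set)" if "T \<in> cutsets E - {T'}" for T
    using that kill nonstandard_if_monomial_prime_kills[OF assms(1), of T T' v' m]
    by (simp add: initial_mons_cutset_prime[OF assms(1)])
  then have "Poly_Mapping.single m 1 ^ card (cutsets E - {T'}) \<in> initial_ideal ?Q"
    by (intro initial_monomial_power_mem prime_imp_ideal prime_cutset_prime[OF assms(1)]) auto
  then have "Poly_Mapping.single m 1 \<in> initial_ideal ?Q"
    using rad unfolding is_radical_ideal_def by blast
  then have "m \<in> initial_mons ?Q"
    unfolding mem_initial_ideal_iff[OF idlQ] by simp
  then obtain q where q: "q \<in> ?Q" "q \<noteq> 0" "initial_mon q = m"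
    by (auto simp: initial_mons_def)
  define g where "g = homogeneous_component ?d q"
  have keys: "Poly_Mapping.keys g = Poly_Mapping.keys q \<inter> {k. mon_degree k = ?d}"
    unfolding g_def homogeneous_component_def by (rule keys_restrict)
  have gQ: "g \<in> ?Q"
    using q(1) homogeneous_component_cutset_prime[OF assms(1)] by (auto simp: g_def)
  have hom: "g \<in> homogeneous_part ?d"
    by (auto simp: homogeneous_part_def keys)
  have mg: "m \<in> Poly_Mapping.keys g"
    using initial_mon_in_keys[OF q(2)] q(3) by (simp add: keys)
  have lead: "g \<noteq> 0" "initial_mon g = m"
  proof -
    show "g \<noteq> 0"
      using mg by auto
    show "initial_mon g = m"
      using mg keys_le_initial_mon[of _ q] q(3) by (intro initial_mon_eqI) (auto simp: keys)
  qed
  have "g \<notin> ?p"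
  proof
    assume "g \<in> ?p"
    then have "m \<in> initial_mons ?p"
      using lead by (auto simp: initial_mons_def)
    then show False
      using standard_for_if_avoids_prime_vars[OF assms(1) avoid]
      by (simp add: initial_mons_cutset_prime[OF assms(1)])
  qed
  have "colon ?J g = ?p"
  proof (intro set_eqI iffI)
    fix a assume "a \<in> colon ?J g"
    then have "a * g \<in> ?p"
      unfolding colon_def JQ by blast
    with \<open>g \<notin> ?p\<close> show "a \<in> ?p"
      using prime_cutset_prime[OF assms(1)] unfolding is_prime_ideal_def by blast
  next
    fix a assume "a \<in> ?p"
    then have "a * g \<in> ?p"
      by (rule ideal_mult_right[OF prime_imp_ideal[OF prime_cutset_prime[OF assms(1)]]])
    moreover have "a * g \<in> ?Q"
      using gQ by (rule ideal_mult[OF idlQ])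
    ultimately show "a \<in> colon ?J g"
      unfolding colon_def JQ by simp
  qed
  then have "?p \<in> Ass ?J" "v_local ?p ?J \<le> enat ?d"
    using prime_cutset_prime[OF assms(1), of T', where 'k = 'k] hom
    unfolding Ass_def v_local_def by (auto intro!: Inf_lower)
  then show ?thesis
    unfolding v_number_def by (meson INF_lower order_trans)
qed

theorem theorem3p15:
  fixes E :: "('n::{finite,linorder} \<times> 'n) set"
    and T' :: "'n set"
    and v' :: "'n set \<Rightarrow> 'n"
  assumes "sym E" and "irrefl E"
    and "T' \<in> cutsets E"
    and "v' \<in> (\<Pi> C\<in>components_on E (- T'). C)"
    and "(monomial_prime E T' v' :: ('n, 'k::field) bpoly set)
           \<in> Ass (initial_ideal (binomial_edge_ideal E))"
    and "v_number (initial_ideal (binomial_edge_ideal E :: ('n, 'k) bpoly set))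
           = v_local (monomial_prime E T' v') (initial_ideal (binomial_edge_ideal E))"
    and "is_radical_ideal
           (initial_ideal (\<Inter>T\<in>cutsets E - {T'}. cutset_prime E T :: ('n, 'k) bpoly set))"
  shows "v_number (binomial_edge_ideal E :: ('n, 'k) bpoly set)
           \<le> v_number (initial_ideal (binomial_edge_ideal E :: ('n, 'k) bpoly set))"
proof -
  \<comment> \<open>The local v-number in the hypothesis may be taken over a field \<open>'a\<close> different from \<open>'k\<close>;
      its witnesses \<open>f\<close> reach \<open>'k\<close> through the exponent \<open>m\<close>.\<close>
  have "v_number (binomial_edge_ideal E :: ('n, 'k) bpoly set) \<le> enat d"
    if f: "f \<in> homogeneous_part d"
      and colon: "colon (initial_ideal (binomial_edge_ideal E)) f = monomial_prime E T' v'"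
    for d and f :: "('n, 'a::field) bpoly"
  proof -
    obtain m where "mon_degree m = d"
      and "\<forall>u\<in>prime_vars E T' v'. Poly_Mapping.lookup m u = 0"
      and "\<forall>u\<in>prime_vars E T' v'. \<forall>T\<in>cutsets E. \<not> standard_for E T (Poly_Mapping.single u 1 + m)"
      using monomial_witness_of_colon[OF assms(1) f colon] by (elim exE conjE)
    then show ?thesis
      using v_number_le_degree_of_monomial_witness[OF assms(1,3,7), of v' m] by simp
  qed
  then show ?thesis
    unfolding assms(6) v_local_def by (intro Inf_greatest) auto
qed

end
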